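(* Lossless graph summarization is in P. More precisely, let $G=(V,E)$ be a finite simple undirected graph, and consider the following algorithm. Initially all nodes are unmarked. For each node $u\in V$ (in any order) that is still unmarked: create the supernode $S(u)=\{u\}$, mark $u$, and then for each unmarked $v\in V$, if $N(u)=N(v)$ or $N(u)\setminus\{v\}=N(v)\setminus\{u\}$, add $v$ to $S(u)$ and mark $v$; record $S(u)$ as a supernode. Finally, for every pair of recorded supernodes $S,S'$ (possibly $S=S'$), add the superedge $\{S,S'\}$ if and only if there exist $u\in S$, $v\in S'$ with $\{u,v\}\in E$. Then this algorithm runs in time polynomial in the size of $G$, and its output is a lossless summary of $G$ whose number of supernodes is minimum among all lossless summaries of $G$.
   Context: $N(u)$ denotes the set of neighbours of $u$ in $G$. A summary of $G$ is a pair $(\mathcal{V},\mathcal{E})$ where $\mathcal{V}$ is a partition of $V$ into nonempty sets (supernodes) and $\mathcal{E}$ a set of unordered pairs $\{S_i,S_j\}$ of supernodes ($i=j$ allowed, a self-loop), called superedges. Its reconstruction is the simple graph on $V$ containing, for each superedge $\{S_i,S_j\}$ with $i\neq j$, all pairs $\{u,w\}$ with $u\in S_i, w\in S_j$, and for each self-loop $\{S_i,S_i\}$, all pairs of distinct nodes of $S_i$. The summary is lossless if its reconstruction equals $G$. The lossless graph summarization problem asks, given $G$, for a lossless summary minimizing the number $|\mathcal{V}|$ of supernodes. *)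

theory Defs
  imports
    "HOL-Library.Disjoint_Sets"
    "HOL-Library.Log_Nat"
    "HOL-Computational_Algebra.Polynomial"
begin

section \<open>Graphs and lossless summaries\<close>

definition simple_graph :: "'a set \<Rightarrow> 'a set set \<Rightarrow> bool" where
  "simple_graph V E \<longleftrightarrow> finite V \<and> (\<forall>e\<in>E. e \<subseteq> V \<and> card e = 2)"

definition nbrs :: "'a set set \<Rightarrow> 'a \<Rightarrow> 'a set" where
  "nbrs E u = {v. {u, v} \<in> E}"

text \<open>A superedge is an unordered pair \<open>{S, T}\<close> of supernodes, so the self-loop at \<open>S\<close> is the
  singleton \<open>{S, S} = {S}\<close>.\<close>

type_synonym 'a summary = "'a set set \<times> 'a set set set"

fun is_summary :: "'a set \<Rightarrow> 'a summary \<Rightarrow> bool" where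
  "is_summary V (P, Q) \<longleftrightarrow> partition_on V P \<and> Q \<subseteq> {{S, T} |S T. S \<in> P \<and> T \<in> P}"

fun reconstruction_edges :: "'a summary \<Rightarrow> 'a set set" where
  "reconstruction_edges (P, Q) =
     {{u, w} |u w S T. {S, T} \<in> Q \<and> S \<noteq> T \<and> u \<in> S \<and> w \<in> T} \<union>
     {{u, w} |u w S. {S, S} \<in> Q \<and> u \<in> S \<and> w \<in> S \<and> u \<noteq> w}"

text \<open>The reconstruction has vertex set \<open>V\<close> by construction, so equality with the graph is
  equality of the edge sets.\<close>

definition is_lossless_summary :: "'a set \<Rightarrow> 'a set set \<Rightarrow> 'a summary \<Rightarrow> bool" where
  "is_lossless_summary V E \<Sigma> \<longleftrightarrow> is_summary V \<Sigma> \<and> reconstruction_edges \<Sigma> = E"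

definition num_supernodes :: "'a summary \<Rightarrow> nat" where
  "num_supernodes \<Sigma> = card (fst \<Sigma>)"

definition is_minimum_lossless_summary :: "'a set \<Rightarrow> 'a set set \<Rightarrow> 'a summary \<Rightarrow> bool" where
  "is_minimum_lossless_summary V E \<Sigma> \<longleftrightarrow>
     is_lossless_summary V E \<Sigma> \<and>
     (\<forall>\<Sigma>'. is_lossless_summary V E \<Sigma>' \<longrightarrow> num_supernodes \<Sigma> \<le> num_supernodes \<Sigma>')"


section \<open>The algorithm\<close>

text \<open>\<open>for_each body X s s'\<close>: executing \<open>body\<close> once for each element of \<open>X\<close>, in some
  arbitrary order, can lead from state \<open>s\<close> to state \<open>s'\<close>.\<close>

inductive for_each :: "('a \<Rightarrow> 's \<Rightarrow> 's \<Rightarrow> bool) \<Rightarrow> 'a set \<Rightarrow> 's \<Rightarrow> 's \<Rightarrow> bool"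
  for body :: "'a \<Rightarrow> 's \<Rightarrow> 's \<Rightarrow> bool" where
  for_each_empty: "for_each body {} s s"
| for_each_step: "x \<in> X \<Longrightarrow> body x s s' \<Longrightarrow> for_each body (X - {x}) s' s'' \<Longrightarrow> for_each body X s s''"

text \<open>The inner state consists of the current supernode \<open>S\<close> and the set \<open>M\<close> of marked nodes.\<close>

fun absorb :: "'a set set \<Rightarrow> 'a \<Rightarrow> 'a \<Rightarrow> 'a set \<times> 'a set \<Rightarrow> 'a set \<times> 'a set \<Rightarrow> bool" where
  "absorb E u v (S, M) \<sigma> \<longleftrightarrow>
     \<sigma> = (if nbrs E u = nbrs E v \<or> nbrs E u - {v} = nbrs E v - {u}
          then (insert v S, insert v M) else (S, M))"

text \<open>The outer state consists of the set \<open>M\<close> of marked nodes and the set \<open>R\<close> of recorded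
  supernodes.\<close>

fun visit :: "'a set \<Rightarrow> 'a set set \<Rightarrow> 'a \<Rightarrow> 'a set \<times> 'a set set \<Rightarrow> 'a set \<times> 'a set set \<Rightarrow> bool" where
  "visit V E u (M, R) \<sigma> \<longleftrightarrow>
     (if u \<in> M then \<sigma> = (M, R)
      else \<exists>S M'. for_each (absorb E u) (V - insert u M) ({u}, insert u M) (S, M') \<and>
                  \<sigma> = (M', insert S R))"

definition algorithm_output :: "'a set \<Rightarrow> 'a set set \<Rightarrow> 'a summary \<Rightarrow> bool" where
  "algorithm_output V E \<Sigma> \<longleftrightarrow>
     (\<exists>M R. for_each (visit V E) V ({}, {}) (M, R) \<and>
            \<Sigma> = (R, {{S, S'} |S S'. S \<in> R \<and> S' \<in> R \<and> (\<exists>u\<in>S. \<exists>v\<in>S'. {u, v} \<in> E)}))"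


section \<open>A random access machine\<close>

text \<open>
  Running time is measured on a unit-cost random access machine programmed by while programs.
  Every memory cell holds a natural number and is addressed by a name and two computed indices.
  The only arithmetic operations are constants and addition, so a number at most doubles (up to
  constants) per step and polynomial time on this machine is polynomial time on Turing machines;
  unit-cost multiplication would destroy this.
\<close>

type_synonym state = "string \<times> nat \<times> nat \<Rightarrow> nat"

datatype aexp = N nat | Cell string aexp aexp | Plus aexp aexp

datatype bexp = Eq aexp aexp | Less aexp aexp | Not bexp | And bexp bexp | Or bexp bexp | Iff bexp bexp

datatype com =
    Skip
  | Store string aexp aexp aexp
  | Seq com com  (infixr ";;" 60)
  | If bexp com com
  | While bexp com

fun aval :: "aexp \<Rightarrow> state \<Rightarrow> nat" where
  "aval (N n) s = n"
| "aval (Cell x i j) s = s (x, aval i s, aval j s)"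
| "aval (Plus a b) s = aval a s + aval b s"

fun bval :: "bexp \<Rightarrow> state \<Rightarrow> bool" where
  "bval (Eq a b) s \<longleftrightarrow> aval a s = aval b s"
| "bval (Less a b) s \<longleftrightarrow> aval a s < aval b s"
| "bval (Not b) s \<longleftrightarrow> \<not> bval b s"
| "bval (And b c) s \<longleftrightarrow> bval b s \<and> bval c s"
| "bval (Or b c) s \<longleftrightarrow> bval b s \<or> bval c s"
| "bval (Iff b c) s \<longleftrightarrow> (bval b s \<longleftrightarrow> bval c s)"

fun acost :: "aexp \<Rightarrow> nat" where
  "acost (N n) = 1"
| "acost (Cell x i j) = 1 + acost i + acost j"
| "acost (Plus a b) = 1 + acost a + acost b"

fun bcost :: "bexp \<Rightarrow> nat" where
  "bcost (Eq a b) = 1 + acost a + acost b"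
| "bcost (Less a b) = 1 + acost a + acost b"
| "bcost (Not b) = 1 + bcost b"
| "bcost (And b c) = 1 + bcost b + bcost c"
| "bcost (Or b c) = 1 + bcost b + bcost c"
| "bcost (Iff b c) = 1 + bcost b + bcost c"

text \<open>\<open>exec c s t s'\<close>: started in \<open>s\<close>, the program \<open>c\<close> halts in \<open>s'\<close> after \<open>t\<close> steps.\<close>

inductive exec :: "com \<Rightarrow> state \<Rightarrow> nat \<Rightarrow> state \<Rightarrow> bool" where
  exec_Skip: "exec Skip s 1 s"
| exec_Store: "exec (Store x i j a) s (1 + acost i + acost j + acost a)
                 (s((x, aval i s, aval j s) := aval a s))"
| exec_Seq: "exec c s t s' \<Longrightarrow> exec d s' t' s'' \<Longrightarrow> exec (c ;; d) s (t + t') s''"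
| exec_IfTrue: "bval b s \<Longrightarrow> exec c s t s' \<Longrightarrow> exec (If b c d) s (1 + bcost b + t) s'"
| exec_IfFalse: "\<not> bval b s \<Longrightarrow> exec d s t s' \<Longrightarrow> exec (If b c d) s (1 + bcost b + t) s'"
| exec_WhileFalse: "\<not> bval b s \<Longrightarrow> exec (While b c) s (1 + bcost b) s"
| exec_WhileTrue: "bval b s \<Longrightarrow> exec c s t s' \<Longrightarrow> exec (While b c) s' t' s'' \<Longrightarrow>
                   exec (While b c) s (1 + bcost b + t + t') s''"

lemma exec_deterministic:
  "exec c s t s' \<Longrightarrow> exec c s u s'' \<Longrightarrow> t = u \<and> s' = s''"
proof (induction c s t s' arbitrary: u s'' rule: exec.induct)
  case (exec_Seq c s t s' d t' s2)
  from exec_Seq.prems show ?case by cases (use exec_Seq.IH in blast)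
next
  case (exec_IfTrue b s c t s' d)
  from exec_IfTrue.prems exec_IfTrue.hyps(1) show ?case by cases (use exec_IfTrue.IH in blast)+
next
  case (exec_IfFalse b s d t s' c)
  from exec_IfFalse.prems exec_IfFalse.hyps(1) show ?case by cases (use exec_IfFalse.IH in blast)+
next
  case (exec_WhileTrue b s c t s' t' s2)
  from exec_WhileTrue.prems exec_WhileTrue.hyps(1) show ?case
    by cases (use exec_WhileTrue.IH in blast)+
qed (erule exec.cases; blast)+

definition runs_in_poly_time ::
    "com \<Rightarrow> 'i set \<Rightarrow> ('i \<Rightarrow> nat) \<Rightarrow> ('i \<Rightarrow> state) \<Rightarrow> ('i \<Rightarrow> state \<Rightarrow> bool) \<Rightarrow> bool" where
  "runs_in_poly_time c I size_of encode post \<longleftrightarrow>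
     (\<exists>p :: nat poly. \<forall>x\<in>I. \<exists>t s.
        exec c (encode x) t s \<and> t \<le> poly p (size_of x) \<and> post x s)"

abbreviation Var :: "string \<Rightarrow> aexp" where "Var x \<equiv> Cell x (N 0) (N 0)"
abbreviation Arr :: "string \<Rightarrow> aexp \<Rightarrow> aexp" where "Arr x i \<equiv> Cell x i (N 0)"

abbreviation SetVar :: "string \<Rightarrow> aexp \<Rightarrow> com" where "SetVar x a \<equiv> Store x (N 0) (N 0) a"
abbreviation SetArr :: "string \<Rightarrow> aexp \<Rightarrow> aexp \<Rightarrow> com" where "SetArr x i a \<equiv> Store x i (N 0) a"

abbreviation When :: "bexp \<Rightarrow> com \<Rightarrow> com" where "When b c \<equiv> If b c Skip"

definition For :: "string \<Rightarrow> aexp \<Rightarrow> com \<Rightarrow> com" where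
  "For x a c = SetVar x (N 0) ;; While (Less (Var x) a) (c ;; SetVar x (Plus (Var x) (N 1)))"


section \<open>The algorithm as a machine program\<close>

text \<open>
  A graph is presented to the machine by a numbering \<open>us\<close> of its nodes: cell \<open>n\<close> holds
  the number of nodes and the cells \<open>adj\<close> the adjacency matrix; all other cells are \<open>0\<close>.
  The numbering is arbitrary and determines the order in which the program visits the nodes.
\<close>

definition presented_graphs :: "('a list \<times> 'a set set) set" where
  "presented_graphs = {(us, E). distinct us \<and> simple_graph (set us) E}"

fun graph_size :: "'a list \<times> 'a set set \<Rightarrow> nat" where
  "graph_size (us, E) = card (set us) + card E"

fun encode_graph :: "'a list \<times> 'a set set \<Rightarrow> state" where
  "encode_graph (us, E) = (\<lambda>(x, i, j).
     if x = ''n'' \<and> i = 0 \<and> j = 0 then length us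
     else if x = ''adj'' \<and> i < length us \<and> j < length us \<and> {us ! i, us ! j} \<in> E then 1
     else 0)"

text \<open>The program stores in \<open>cls[i]\<close> the index of the supernode containing node \<open>i\<close>; the
  supernodes are numbered from \<open>0\<close> in the order of their creation and \<open>k\<close> counts them.\<close>

definition compare_nbrs :: com where
  "compare_nbrs =
     SetVar ''eq'' (N 1) ;;
     SetVar ''eq_minus'' (N 1) ;;
     For ''w'' (Var ''n'')
       (When (Not (Eq (Cell ''adj'' (Var ''u'') (Var ''w'')) (Cell ''adj'' (Var ''v'') (Var ''w''))))
          (SetVar ''eq'' (N 0)) ;;
        When (Not (Iff
                (And (Eq (Cell ''adj'' (Var ''u'') (Var ''w'')) (N 1)) (Not (Eq (Var ''w'') (Var ''v''))))
                (And (Eq (Cell ''adj'' (Var ''v'') (Var ''w'')) (N 1)) (Not (Eq (Var ''w'') (Var ''u''))))))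
          (SetVar ''eq_minus'' (N 0)))"

definition build_supernodes :: com where
  "build_supernodes =
     SetVar ''k'' (N 0) ;;
     For ''u'' (Var ''n'')
       (When (Eq (Arr ''mark'' (Var ''u'')) (N 0))
          (SetArr ''cls'' (Var ''u'') (Var ''k'') ;;
           SetArr ''mark'' (Var ''u'') (N 1) ;;
           For ''v'' (Var ''n'')
             (When (Eq (Arr ''mark'' (Var ''v'')) (N 0))
                (compare_nbrs ;;
                 When (Or (Eq (Var ''eq'') (N 1)) (Eq (Var ''eq_minus'') (N 1)))
                   (SetArr ''cls'' (Var ''v'') (Var ''k'') ;;
                    SetArr ''mark'' (Var ''v'') (N 1)))) ;;
           SetVar ''k'' (Plus (Var ''k'') (N 1))))"

definition build_superedges :: com where
  "build_superedges =
     For ''a'' (Var ''k'') (For ''b'' (Var ''k'')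
       (For ''u'' (Var ''n'') (For ''v'' (Var ''n'')
         (When (And (And (Eq (Arr ''cls'' (Var ''u'')) (Var ''a'')) (Eq (Arr ''cls'' (Var ''v'')) (Var ''b'')))
                    (Eq (Cell ''adj'' (Var ''u'') (Var ''v'')) (N 1)))
            (Store ''sedge'' (Var ''a'') (Var ''b'') (N 1))))))"

definition summarize :: com where
  "summarize = build_supernodes ;; build_superedges"

definition stored_supernode :: "'a list \<Rightarrow> state \<Rightarrow> nat \<Rightarrow> 'a set" where
  "stored_supernode us s a = {us ! i |i. i < length us \<and> s (''cls'', i, 0) = a}"

definition stored_summary :: "'a list \<Rightarrow> state \<Rightarrow> 'a summary" where
  "stored_summary us s =
     (stored_supernode us s ` {..<s (''k'', 0, 0)},
      {{stored_supernode us s a, stored_supernode us s b} |a b.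
         a < s (''k'', 0, 0) \<and> b < s (''k'', 0, 0) \<and> s (''sedge'', a, b) = 1})"


section \<open>The decision problem\<close>

text \<open>Instances are pairs of a presented graph and a bound \<open>k\<close>, given in cell \<open>bound\<close>; the
  question is whether there is a lossless summary with at most \<open>k\<close> supernodes. The bound
  contributes its binary length to the size. The answer is returned in cell \<open>answer\<close>.\<close>

fun decision_size :: "('a list \<times> 'a set set) \<times> nat \<Rightarrow> nat" where
  "decision_size (g, k) = graph_size g + floorlog 2 k"

fun encode_decision :: "('a list \<times> 'a set set) \<times> nat \<Rightarrow> state" where
  "encode_decision (g, k) = (encode_graph g)((''bound'', 0, 0) := k)"

definition summarizable :: "(('a list \<times> 'a set set) \<times> nat) set" where
  "summarizable = {((us, E), k).
     \<exists>\<Sigma>. is_lossless_summary (set us) E \<Sigma> \<and> num_supernodes \<Sigma> \<le> k}"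

definition summarization_in_P :: "'a itself \<Rightarrow> bool" where
  "summarization_in_P _ \<longleftrightarrow>
     (\<exists>c. runs_in_poly_time c ((presented_graphs :: ('a list \<times> 'a set set) set) \<times> UNIV)
            decision_size encode_decision
            (\<lambda>x s. s (''answer'', 0, 0) = (if x \<in> summarizable then 1 else 0)))"

end

theory Submission
  imports Defs
begin

text \<open>
  Two nodes are twins if no third node distinguishes them, and being twins is an equivalence
  relation. Nodes in the same supernode of a lossless summary are twins, so the partition of any
  lossless summary refines the partition into twin classes. Conversely, adjacency of two distinct
  nodes depends only on their twin classes, so the twin classes with the induced superedges form
  a lossless summary, which is therefore minimum; and they are what the algorithm outputs, because
  the set of marked nodes is always a union of twin classes. Comparing the minimum with a given
  bound solves the decision problem.
\<close>

section \<open>Twin classes\<close>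

text \<open>Simplicity of the graph is what makes twins an equivalence relation: without loops the
  test of the algorithm amounts to agreement on all third nodes, and adjacent and non-adjacent twins
  then never mix in one class. Every class is a clique or an independent set, which is exactly what
  a self-loop, or its absence, can express.

  Optimality and running time are kept apart. Optimality is shown for every run of the
  nondeterministic algorithm. The machine program is shown only to follow one such run: its loop
  invariant carries a partial \<open>for_each\<close> run as a ghost component, so the facts about
  twin classes are not proved again for arrays.

  Time and functional behaviour of the program are handled by the single judgement
  \<open>run\<close>. The cost of loop-free code is read off its syntax and each loop iteration gets
  a uniform bound, so all time bounds are explicit polynomials in the number of nodes.\<close>

text \<open>Literally the test in \<open>absorb\<close>, so that the algorithm unfolds to it;
  arguments about adjacency use \<open>twin_iff\<close> instead.\<close>

definition twin :: "'a set set \<Rightarrow> 'a \<Rightarrow> 'a \<Rightarrow> bool" where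
  "twin E u v \<longleftrightarrow> nbrs E u = nbrs E v \<or> nbrs E u - {v} = nbrs E v - {u}"

definition twin_class :: "'a set \<Rightarrow> 'a set set \<Rightarrow> 'a \<Rightarrow> 'a set" where
  "twin_class V E u = {v \<in> V. twin E u v}"

lemma simple_graph_no_loop: "simple_graph V E \<Longrightarrow> {u} \<notin> E"
  by (auto simp: simple_graph_def)

lemma simple_graph_edgeD: "simple_graph V E \<Longrightarrow> {u, v} \<in> E \<Longrightarrow> u \<in> V \<and> v \<in> V \<and> u \<noteq> v"
  by (auto simp: simple_graph_def)

text \<open>Without loops, \<open>u\<close> and \<open>v\<close> themselves lie in neither side of
  \<open>nbrs E u - {v} = nbrs E v - {u}\<close>, so only third nodes can make a difference.\<close>

lemma twin_iff:
  assumes "simple_graph V E"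
  shows "twin E u v \<longleftrightarrow> (\<forall>w. w \<noteq> u \<longrightarrow> w \<noteq> v \<longrightarrow> {u, w} \<in> E \<longleftrightarrow> {v, w} \<in> E)"
proof
  show "twin E u v \<Longrightarrow> \<forall>w. w \<noteq> u \<longrightarrow> w \<noteq> v \<longrightarrow> {u, w} \<in> E \<longleftrightarrow> {v, w} \<in> E"
    by (auto simp: twin_def nbrs_def)
next
  assume *: "\<forall>w. w \<noteq> u \<longrightarrow> w \<noteq> v \<longrightarrow> {u, w} \<in> E \<longleftrightarrow> {v, w} \<in> E"
  have loops: "{u, u} \<notin> E" "{v, v} \<notin> E" using simple_graph_no_loop[OF assms] by auto
  have "x \<in> nbrs E u - {v} \<longleftrightarrow> x \<in> nbrs E v - {u}" for x
    using * loops by (cases "x = u"; cases "x = v") (auto simp: nbrs_def)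
  then show "twin E u v" unfolding twin_def by blast
qed

lemma twin_refl [simp]: "twin E u u"
  by (simp add: twin_def)

lemma twin_sym: "twin E u v \<Longrightarrow> twin E v u"
  by (auto simp: twin_def)

lemma twin_trans:
  assumes "simple_graph V E" "twin E u v" "twin E v w"
  shows "twin E u w"
proof (cases "u = v \<or> v = w \<or> u = w")
  case True
  then show ?thesis using assms by auto
next
  case False
  have uv: "{u, x} \<in> E \<longleftrightarrow> {v, x} \<in> E" if "x \<noteq> u" "x \<noteq> v" for x
    using assms(2) that unfolding twin_iff[OF assms(1)] by blast
  have vw: "{v, x} \<in> E \<longleftrightarrow> {w, x} \<in> E" if "x \<noteq> v" "x \<noteq> w" for x
    using assms(3) that unfolding twin_iff[OF assms(1)] by blast
  have "{u, x} \<in> E \<longleftrightarrow> {w, x} \<in> E" if "x \<noteq> u" "x \<noteq> w" for x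
  proof (cases "x = v")
    case True
    \<comment> \<open>Neither hypothesis compares adjacency to the middle node \<open>v\<close>.
      Going around the triangle does: \<open>v\<close> and \<open>w\<close> agree on
      \<open>u\<close>, then \<open>u\<close> and \<open>v\<close> agree on
      \<open>w\<close>.\<close>
    have "{u, v} \<in> E \<longleftrightarrow> {w, u} \<in> E" using vw[of u] False by (simp add: insert_commute)
    also have "\<dots> \<longleftrightarrow> {v, w} \<in> E" using uv[of w] False by (auto simp add: insert_commute)
    finally show ?thesis using True by (simp add: insert_commute)
  qed (use uv vw that in blast)
  then show ?thesis unfolding twin_iff[OF assms(1)] by blast
qed

lemma twin_class_eq_iff:
  assumes "simple_graph V E" "u \<in> V"
  shows "twin_class V E v = twin_class V E u \<longleftrightarrow> twin E v u"
proof
  assume eq: "twin_class V E v = twin_class V E u"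
  have "u \<in> twin_class V E u" using assms by (simp add: twin_class_def)
  then have "u \<in> twin_class V E v" by (simp only: eq)
  then show "twin E v u" by (simp add: twin_class_def)
next
  assume "twin E v u"
  then have "twin E v x \<longleftrightarrow> twin E u x" for x
    using twin_trans[OF assms(1), of v u x] twin_trans[OF assms(1), of u v x] twin_sym[of E v u]
    by blast
  then show "twin_class V E v = twin_class V E u" by (simp add: twin_class_def)
qed

lemma partition_on_twin_classes:
  assumes "simple_graph V E"
  shows "partition_on V (twin_class V E ` V)"
proof (rule partition_onI)
  show "\<Union> (twin_class V E ` V) = V" by (auto simp: twin_class_def)
  show "{} \<notin> twin_class V E ` V" using twin_refl by (fastforce simp: twin_class_def)
next
  fix p q assume pq: "p \<in> twin_class V E ` V" "q \<in> twin_class V E ` V" "p \<noteq> q"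
  then obtain u v where uv: "u \<in> V" "v \<in> V" "p = twin_class V E u" "q = twin_class V E v"
    by auto
  then have "\<not> twin E u v" using pq(3) twin_class_eq_iff[OF assms uv(2)] by blast
  then have "\<not> (twin E u w \<and> twin E v w)" for w
    using twin_trans[OF assms, of u w v] twin_sym[of E v w] by blast
  then show "disjnt p q" unfolding uv disjnt_def twin_class_def by blast
qed

text \<open>The endpoints are replaced one at a time. This fails only if \<open>u' = w\<close>,
  where the intermediate pair would be a loop; then all four nodes are twins, and \<open>u\<close>
  can be moved to \<open>w'\<close> directly while \<open>w\<close> stays. The case covers edges
  inside one twin class.\<close>

lemma twins_adjacent_replace:
  assumes "simple_graph V E" "{u, w} \<in> E" "twin E u u'" "twin E w w'"
    and "u' \<noteq> w'" and "u' = w \<Longrightarrow> twin E u' w'"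
  shows "{u', w'} \<in> E"
proof -
  have tw: "{a, x} \<in> E \<longleftrightarrow> {b, x} \<in> E" if "twin E a b" "x \<noteq> a" "x \<noteq> b" for a b x
    using that twin_iff[OF assms(1)] by blast
  have "u \<noteq> w" using simple_graph_edgeD[OF assms(1,2)] by simp
  show ?thesis
  proof (cases "u' = w")
    case False
    then have "{u', w} \<in> E" using tw[OF assms(3), of w] assms(2) \<open>u \<noteq> w\<close> by auto
    then show ?thesis using tw[OF assms(4), of u'] False assms(5) by (auto simp: insert_commute)
  next
    case True
    then have "twin E w w'" "twin E u w'"
      using assms twin_trans[OF assms(1)] by blast+
    then show ?thesis
      using tw[of u w' w] True assms(2,5) \<open>u \<noteq> w\<close> by (auto simp: insert_commute)
  qed
qed

section \<open>The twin partition gives a minimum lossless summary\<close>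

text \<open>The superedge set of \<open>algorithm_output\<close>, as a function of the supernodes
  alone.\<close>

definition induced_superedges :: "'a set set \<Rightarrow> 'a set set \<Rightarrow> 'a set set set" where
  "induced_superedges E R =
     {{S, S'} |S S'. S \<in> R \<and> S' \<in> R \<and> (\<exists>u\<in>S. \<exists>v\<in>S'. {u, v} \<in> E)}"

lemma mem_induced_superedges:
  "{S, T} \<in> induced_superedges E R \<longleftrightarrow> S \<in> R \<and> T \<in> R \<and> (\<exists>u\<in>S. \<exists>v\<in>T. {u, v} \<in> E)"
  unfolding induced_superedges_def by (auto simp: doubleton_eq_iff) (metis insert_commute)

text \<open>Disjointness leaves one possible supernode for each endpoint, and swapping them does not
  change the unordered pair. Since \<open>{S, S}\<close> is the self-loop, \<open>S = T\<close>
  needs no separate formula. The equivalence serves twice: to show that the twin classes are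
  lossless and that supernodes of any lossless summary consist of twins.\<close>

lemma reconstruction_edges_iff:
  assumes "partition_on V P" "u \<noteq> w" "S \<in> P" "T \<in> P" "u \<in> S" "w \<in> T"
    and "Q \<subseteq> {{S, T} |S T. S \<in> P \<and> T \<in> P}"
  shows "{u, w} \<in> reconstruction_edges (P, Q) \<longleftrightarrow> {S, T} \<in> Q"
proof
  have uniq: "A = B" if "x \<in> A" "x \<in> B" "A \<in> P" "B \<in> P" for x A B
    using that partition_onD2[OF assms(1)] by (auto simp: disjoint_def)
  have inP: "A \<in> P \<and> B \<in> P" if "{A, B} \<in> Q" for A B
    using that \<open>Q \<subseteq> _\<close> by (fastforce simp: doubleton_eq_iff)
  show "{S, T} \<in> Q" if "{u, w} \<in> reconstruction_edges (P, Q)"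
  proof -
    obtain x y A B where "{u, w} = {x, y}" and AB: "{A, B} \<in> Q" "x \<in> A" "y \<in> B"
      using \<open>{u, w} \<in> _\<close> unfolding reconstruction_edges.simps by blast
    then have "u \<in> A \<and> w \<in> B \<or> w \<in> A \<and> u \<in> B" by (auto simp: doubleton_eq_iff)
    then have "A = S \<and> B = T \<or> A = T \<and> B = S" using uniq inP[OF AB(1)] assms(3-6) by metis
    then show ?thesis using AB(1) by (auto simp: insert_commute)
  qed
  show "{S, T} \<in> Q \<Longrightarrow> {u, w} \<in> reconstruction_edges (P, Q)"
    using assms(2,5,6) unfolding reconstruction_edges.simps by (cases "S = T"; blast)
qed

lemma twin_classes_lossless:
  assumes G: "simple_graph V E"
  defines "R \<equiv> twin_class V E ` V"
  shows "is_lossless_summary V E (R, induced_superedges E R)"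
proof -
  let ?Q = "induced_superedges E R"
  have P: "partition_on V R" unfolding R_def by (rule partition_on_twin_classes[OF G])
  have Q: "?Q \<subseteq> {{S, T} |S T. S \<in> R \<and> T \<in> R}" unfolding induced_superedges_def by blast
  have same: "{u, w} \<in> reconstruction_edges (R, ?Q) \<longleftrightarrow> {u, w} \<in> E"
    if "u \<in> V" "w \<in> V" "u \<noteq> w" for u w
  proof -
    let ?S = "twin_class V E u" and ?T = "twin_class V E w"
    have mem: "?S \<in> R" "?T \<in> R" "u \<in> ?S" "w \<in> ?T"
      using that by (auto simp: R_def twin_class_def)
    have "(\<exists>x\<in>?S. \<exists>y\<in>?T. {x, y} \<in> E) \<longleftrightarrow> {u, w} \<in> E"
    proof
      assume "\<exists>x\<in>?S. \<exists>y\<in>?T. {x, y} \<in> E"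
      then obtain x y where xy: "twin E u x" "twin E w y" "{x, y} \<in> E"
        by (auto simp: twin_class_def)
      show "{u, w} \<in> E"
        by (rule twins_adjacent_replace[OF G xy(3)]) (use xy twin_sym[of E] that in auto)
    qed (use mem in blast)
    then show ?thesis
      using reconstruction_edges_iff[OF P \<open>u \<noteq> w\<close> mem Q] mem by (simp add: mem_induced_superedges)
  qed
  \<comment> \<open>\<open>same\<close> speaks only of pairs of distinct nodes of \<open>V\<close>;
    it remains to see that both edge sets consist of such pairs. Across two different supernodes,
    distinctness comes from their disjointness.\<close>
  have "reconstruction_edges (R, ?Q) = E"
  proof (rule set_eqI)
    fix e
    have "\<exists>u w. e = {u, w} \<and> u \<in> V \<and> w \<in> V \<and> u \<noteq> w" if e: "e \<in> reconstruction_edges (R, ?Q)"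
    proof -
      obtain u w S T where uw: "e = {u, w}" "u \<in> S" "w \<in> T" "{S, T} \<in> ?Q" "S \<noteq> T \<or> u \<noteq> w"
        using e by auto
      then have ST: "S \<in> R" "T \<in> R" by (auto simp: mem_induced_superedges)
      then have "u \<in> V" "w \<in> V" using uw P by (auto simp: partition_on_def)
      moreover have "u \<noteq> w" using uw ST partition_onD2[OF P] by (auto simp: disjoint_def)
      ultimately show ?thesis using uw(1) by blast
    qed
    moreover have "\<exists>u w. e = {u, w} \<and> u \<in> V \<and> w \<in> V \<and> u \<noteq> w" if "e \<in> E"
    proof -
      from that G have "e \<subseteq> V" "card e = 2" by (auto simp: simple_graph_def)
      then show ?thesis by (auto simp: card_2_iff)
    qed
    ultimately show "e \<in> reconstruction_edges (R, ?Q) \<longleftrightarrow> e \<in> E" using same by blast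
  qed
  then show ?thesis using P Q by (simp add: is_lossless_summary_def)
qed

text \<open>A third node \<open>w\<close> in supernode \<open>T\<close> is joined to
  \<open>u\<close> and to \<open>v\<close> by the same criterion, the presence of
  \<open>{S, T}\<close>. This includes \<open>T = S\<close>, because \<open>w\<close> differs from
  both. Nodes outside \<open>V\<close> have no edges at all.\<close>

lemma lossless_supernode_twins:
  assumes G: "simple_graph V E" and L: "is_lossless_summary V E (P, Q)"
    and "S \<in> P" "u \<in> S" "v \<in> S"
  shows "twin E u v"
  unfolding twin_iff[OF G]
proof (intro allI impI)
  fix w assume w: "w \<noteq> u" "w \<noteq> v"
  have P: "partition_on V P" and Q: "Q \<subseteq> {{S, T} |S T. S \<in> P \<and> T \<in> P}"
    and E: "reconstruction_edges (P, Q) = E"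
    using L by (auto simp: is_lossless_summary_def)
  show "{u, w} \<in> E \<longleftrightarrow> {v, w} \<in> E"
  proof (cases "w \<in> V")
    case True
    then obtain T where "T \<in> P" "w \<in> T" using P by (auto simp: partition_on_def)
    then show ?thesis
      using reconstruction_edges_iff[OF P _ \<open>S \<in> P\<close> \<open>T \<in> P\<close> _ \<open>w \<in> T\<close> Q] assms(4,5) w E by metis
  next
    case False
    then show ?thesis using simple_graph_edgeD[OF G] by blast
  qed
qed

lemma twin_classes_minimum:
  assumes G: "simple_graph V E"
  defines "R \<equiv> twin_class V E ` V"
  shows "is_minimum_lossless_summary V E (R, induced_superedges E R)"
  unfolding is_minimum_lossless_summary_def
proof (intro conjI allI impI)
  show "is_lossless_summary V E (R, induced_superedges E R)"
    unfolding R_def by (rule twin_classes_lossless[OF G])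
next
  fix \<Sigma>' assume L: "is_lossless_summary V E \<Sigma>'"
  obtain P Q where \<Sigma>': "\<Sigma>' = (P, Q)" by (cases \<Sigma>')
  have P: "partition_on V P" using L by (simp add: \<Sigma>' is_lossless_summary_def)
  have "finite P" using P G finite_elements by (auto simp: simple_graph_def)
  \<comment> \<open>Each supernode of the competitor is sent to the twin class of an arbitrary
    member. Every twin class is hit, so there are at least as many supernodes as classes.\<close>
  have "R \<subseteq> (\<lambda>S. twin_class V E (SOME x. x \<in> S)) ` P"
  proof
    fix X assume "X \<in> R"
    then obtain u where u: "u \<in> V" "X = twin_class V E u" by (auto simp: R_def)
    then obtain S where S: "S \<in> P" "u \<in> S" using P by (auto simp: partition_on_def)
    have "(SOME x. x \<in> S) \<in> S" using S(2) by (rule someI)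
    then have "twin E (SOME x. x \<in> S) u"
      using lossless_supernode_twins[OF G] L S \<Sigma>' by blast
    then have "X = twin_class V E (SOME x. x \<in> S)"
      using u twin_class_eq_iff[OF G u(1)] by blast
    then show "X \<in> (\<lambda>S. twin_class V E (SOME x. x \<in> S)) ` P" using S by blast
  qed
  then show "num_supernodes (R, induced_superedges E R) \<le> num_supernodes \<Sigma>'"
    using \<open>finite P\<close> by (simp add: num_supernodes_def \<Sigma>' surj_card_le)
qed

section \<open>The nondeterministic algorithm\<close>

text \<open>\<open>for_each_step\<close> peels off the first element, whereas a program loop extends
  its run at the end. This is the link between the two.\<close>

lemma for_each_snoc:
  "for_each body X s s' \<Longrightarrow> x \<notin> X \<Longrightarrow> body x s' s'' \<Longrightarrow> for_each body (insert x X) s s''"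
proof (induction rule: for_each.induct)
  case (for_each_empty s)
  then show ?case using for_each_step[of x "{x}" body s s'' s''] for_each.for_each_empty[of body s'']
    by simp
next
  case (for_each_step y X s t s')
  then have "insert x X - {y} = insert x (X - {y})" by blast
  moreover have "for_each body (insert x (X - {y})) t s''"
    using for_each_step.IH for_each_step.prems by blast
  ultimately show ?case
    using for_each.for_each_step[of y "insert x X" body s t s''] for_each_step.hyps by simp
qed

text \<open>The test in \<open>absorb\<close> compares with the fixed node \<open>u\<close> and does
  not look at the state, so every order leads to the same result.\<close>

lemma for_each_absorb_result:
  "for_each (absorb E u) X \<sigma> \<sigma>' \<Longrightarrow>
    \<sigma>' = (fst \<sigma> \<union> {v \<in> X. twin E u v}, snd \<sigma> \<union> {v \<in> X. twin E u v})"
proof (induction rule: for_each.induct)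
  case (for_each_step v X s s' s'')
  have "s' = (if twin E u v then (insert v (fst s), insert v (snd s)) else s)"
    using for_each_step.hyps(2) by (cases s) (simp add: twin_def)
  moreover have "{w \<in> X. twin E u w} =
      (if twin E u v then insert v {w \<in> X - {v}. twin E u w} else {w \<in> X - {v}. twin E u w})"
    using for_each_step.hyps(1) by auto
  ultimately show ?case unfolding for_each_step.IH by (cases "twin E u v") simp_all
next
  case (for_each_empty s)
  show ?case by (cases s) simp
qed

lemma for_each_absorb_exists:
  assumes "finite X"
  shows "\<exists>\<sigma>'. for_each (absorb E u) X \<sigma> \<sigma>'"
  using assms
proof (induction X arbitrary: \<sigma> rule: finite_induct)
  case empty
  show ?case by (blast intro: for_each_empty)
next
  case (insert v X)
  obtain S M where "\<sigma> = (S, M)" by (cases \<sigma>)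
  then obtain \<sigma>1 where "absorb E u v \<sigma> \<sigma>1" using absorb.simps[of E u v S M] by blast
  moreover obtain \<sigma>' where "for_each (absorb E u) X \<sigma>1 \<sigma>'" using insert.IH by blast
  ultimately have "for_each (absorb E u) (insert v X) \<sigma> \<sigma>'"
    using for_each_step[of v "insert v X" "absorb E u" \<sigma> \<sigma>1 \<sigma>'] insert.hyps(2) by simp
  then show ?case by blast
qed

text \<open>Existence and uniqueness of the result of the inner loop turn the relation into a
  function. What is recorded here is only the unmarked part of a twin class; that it is the whole
  class depends on the history of \<open>M\<close>.\<close>

lemma visit_iff:
  assumes "finite V" "u \<in> V"
  shows "visit V E u (M, R) \<sigma> \<longleftrightarrow>
    \<sigma> = (if u \<in> M then (M, R) else (M \<union> {v \<in> V - M. twin E u v}, insert {v \<in> V - M. twin E u v} R))"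
proof (cases "u \<in> M")
  case True
  then show ?thesis by simp
next
  case False
  let ?C = "{v \<in> V - M. twin E u v}" and ?X = "V - insert u M"
  have "insert u {v \<in> ?X. twin E u v} = ?C"
    using assms(2) False twin_refl[of E u] by blast
  then have *: "({u} \<union> {v \<in> ?X. twin E u v}, insert u M \<union> {v \<in> ?X. twin E u v}) = (?C, M \<union> ?C)"
    by blast
  have res: "\<sigma>' = (?C, M \<union> ?C)" if "for_each (absorb E u) ?X ({u}, insert u M) \<sigma>'" for \<sigma>'
    using for_each_absorb_result[OF that] * by (simp only: fst_conv snd_conv)
  obtain \<sigma>' where "for_each (absorb E u) ?X ({u}, insert u M) \<sigma>'"
    using for_each_absorb_exists[of ?X E u] assms(1) by blast
  then have ex: "for_each (absorb E u) ?X ({u}, insert u M) (?C, M \<union> ?C)"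
    using res by metis
  have "visit V E u (M, R) \<sigma> \<longleftrightarrow> (\<exists>S M'. for_each (absorb E u) ?X ({u}, insert u M) (S, M') \<and>
      \<sigma> = (M', insert S R))"
    using False by simp
  also have "\<dots> \<longleftrightarrow> \<sigma> = (M \<union> ?C, insert ?C R)"
    using res ex by blast
  finally show ?thesis using False by (simp only: if_False)
qed

text \<open>The hypothesis that matters is closure of the marked set under twins: a marked twin of
  \<open>u\<close> would have forced \<open>u\<close> to be marked, so an unmarked \<open>u\<close>
  has an entirely unmarked class. The invariant is assumed of the start state because the induction
  peels visits off the front.\<close>

lemma for_each_visit_invariant:
  assumes G: "simple_graph V E"
  shows "for_each (visit V E) X \<sigma> \<sigma>' \<Longrightarrow> X \<subseteq> V \<Longrightarrow> fst \<sigma> \<subseteq> V \<Longrightarrow>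
    (\<forall>u\<in>fst \<sigma>. \<forall>v\<in>V. twin E u v \<longrightarrow> v \<in> fst \<sigma>) \<Longrightarrow>
    snd \<sigma> = twin_class V E ` fst \<sigma> \<Longrightarrow>
    fst \<sigma> \<subseteq> fst \<sigma>' \<and> X \<subseteq> fst \<sigma>' \<and> fst \<sigma>' \<subseteq> V \<and> snd \<sigma>' = twin_class V E ` fst \<sigma>'"
proof (induction rule: for_each.induct)
  case (for_each_step u X s s' s'')
  obtain M R where s: "s = (M, R)" by (cases s)
  have fin: "finite V" using G by (simp add: simple_graph_def)
  have u: "u \<in> V" using for_each_step.hyps(1) for_each_step.prems(1) by blast
  have closed: "v \<in> M" if "w \<in> M" "v \<in> V" "twin E w v" for v w
    using for_each_step.prems(3) that unfolding s by simp
  show ?case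
  proof (cases "u \<in> M")
    case True
    then have "s' = s"
      using for_each_step.hyps(2) s by simp
    have "X - {u} \<subseteq> V" using for_each_step.prems(1) by blast
    from for_each_step.IH[unfolded \<open>s' = s\<close>, OF this for_each_step.prems(2,3,4)]
    show ?thesis using True unfolding s fst_conv by blast
  next
    case False
    have C: "{v \<in> V - M. twin E u v} = twin_class V E u"
    proof -
      have "v \<notin> M" if "twin E u v" for v
        using closed[of v u] twin_sym[OF that] u False by blast
      then show ?thesis unfolding twin_class_def by blast
    qed
    then have s': "s' = (M \<union> twin_class V E u, insert (twin_class V E u) R)"
      using for_each_step.hyps(2) False unfolding s visit_iff[OF fin u] by simp
    have sub: "X - {u} \<subseteq> V" using for_each_step.prems(1) by blast
    have cl: "\<forall>w\<in>fst s'. \<forall>v\<in>V. twin E w v \<longrightarrow> v \<in> fst s'"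
    proof (intro ballI impI)
      fix w v assume "w \<in> fst s'" "v \<in> V" "twin E w v"
      then show "v \<in> fst s'"
        using closed[of w v] twin_trans[OF G, of u w v] unfolding s' twin_class_def by auto
    qed
    have snd: "snd s' = twin_class V E ` fst s'"
    proof -
      have "twin_class V E v = twin_class V E u" if "v \<in> twin_class V E u" for v
        using that twin_class_eq_iff[OF G u] twin_sym[of E u v] by (simp add: twin_class_def)
      moreover have "u \<in> twin_class V E u" using u by (simp add: twin_class_def)
      ultimately have "twin_class V E ` twin_class V E u = {twin_class V E u}" by blast
      then show ?thesis using for_each_step.prems(4) by (simp add: s s' image_Un)
    qed
    have "fst s' \<subseteq> V" using for_each_step.prems(2) unfolding s s' by (auto simp: twin_class_def)
    note for_each_step.IH[OF sub this cl snd]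
    moreover have "u \<in> fst s'" "fst s \<subseteq> fst s'" using u by (auto simp: s s' twin_class_def)
    ultimately show ?thesis by blast
  qed
qed auto

lemma algorithm_output_iff:
  "algorithm_output V E \<Sigma> \<longleftrightarrow>
     (\<exists>M R. for_each (visit V E) V ({}, {}) (M, R) \<and> \<Sigma> = (R, induced_superedges E R))"
  by (simp add: algorithm_output_def induced_superedges_def)

lemma algorithm_output_minimum:
  assumes G: "simple_graph V E" and "algorithm_output V E \<Sigma>"
  shows "is_minimum_lossless_summary V E \<Sigma>"
proof -
  obtain M R where M: "for_each (visit V E) V ({}, {}) (M, R)"
    and \<Sigma>: "\<Sigma> = (R, induced_superedges E R)"
    using assms(2) unfolding algorithm_output_iff by blast
  have "V \<subseteq> M \<and> M \<subseteq> V \<and> R = twin_class V E ` M"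
    using for_each_visit_invariant[OF G M subset_refl] by simp
  then have "R = twin_class V E ` V" by blast
  then show ?thesis using twin_classes_minimum[OF G] \<Sigma> by simp
qed

section \<open>Reasoning about the machine\<close>

text \<open>Total correctness together with an upper bound on time. Unlike the exact count in
  \<open>exec\<close>, the bound can be relaxed, so branches and iterations of different cost can
  share one.\<close>

definition run :: "com \<Rightarrow> state \<Rightarrow> nat \<Rightarrow> (state \<Rightarrow> bool) \<Rightarrow> bool" where
  "run c s T Q \<longleftrightarrow> (\<exists>t s'. exec c s t s' \<and> t \<le> T \<and> Q s')"

lemma run_mono:
  assumes "run c s T Q" "T \<le> T'" "\<And>s'. Q s' \<Longrightarrow> Q' s'"
  shows "run c s T' Q'"
  using assms unfolding run_def by (meson le_trans)

lemma run_Seq: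
  assumes "run c s T1 P" "\<And>s'. P s' \<Longrightarrow> run d s' T2 Q"
  shows "run (c ;; d) s (T1 + T2) Q"
proof -
  obtain t1 s1 where 1: "exec c s t1 s1" "t1 \<le> T1" "P s1" using assms(1) unfolding run_def by blast
  obtain t2 s2 where 2: "exec d s1 t2 s2" "t2 \<le> T2" "Q s2"
    using assms(2)[OF 1(3)] unfolding run_def by blast
  show ?thesis unfolding run_def
    using exec_Seq[OF 1(1) 2(1)] 1(2) 2(2,3) add_mono by blast
qed

lemma run_If:
  assumes "bval b s \<Longrightarrow> run c s T Q" "\<not> bval b s \<Longrightarrow> run d s T Q"
  shows "run (If b c d) s (1 + bcost b + T) Q"
proof (cases "bval b s")
  case True
  then obtain t s' where "exec c s t s'" "t \<le> T" "Q s'" using assms(1) unfolding run_def by blast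
  then show ?thesis unfolding run_def
    using exec_IfTrue[OF True, of c t s' d] by (meson add_left_mono)
next
  case False
  then obtain t s' where "exec d s t s'" "t \<le> T" "Q s'" using assms(2) unfolding run_def by blast
  then show ?thesis unfolding run_def
    using exec_IfFalse[OF False, of d t s' c] by (meson add_left_mono)
qed

text \<open>\<open>loop_free\<close>, \<open>result\<close> and \<open>cost_bound\<close> evaluate
  straight-line code symbolically, so that the simplifier can settle its effect and its cost. The
  \<open>While\<close> equations of the latter two are default values, kept out by
  \<open>loop_free\<close>.\<close>

primrec loop_free :: "com \<Rightarrow> bool" where
  "loop_free Skip = True"
| "loop_free (Store x i j a) = True"
| "loop_free (c ;; d) = (loop_free c \<and> loop_free d)"
| "loop_free (If b c d) = (loop_free c \<and> loop_free d)"
| "loop_free (While b c) = False"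

primrec result :: "com \<Rightarrow> state \<Rightarrow> state" where
  "result Skip s = s"
| "result (Store x i j a) s = s((x, aval i s, aval j s) := aval a s)"
| "result (c ;; d) s = result d (result c s)"
| "result (If b c d) s = (if bval b s then result c s else result d s)"
| "result (While b c) s = s"

primrec cost_bound :: "com \<Rightarrow> nat" where
  "cost_bound Skip = 1"
| "cost_bound (Store x i j a) = 1 + acost i + acost j + acost a"
| "cost_bound (c ;; d) = cost_bound c + cost_bound d"
| "cost_bound (If b c d) = 1 + bcost b + max (cost_bound c) (cost_bound d)"
| "cost_bound (While b c) = 0"

lemma run_loop_free_cost_bound: "loop_free c \<Longrightarrow> Q (result c s) \<Longrightarrow> run c s (cost_bound c) Q"
proof (induction c arbitrary: s Q)
  case Skip
  then show ?case unfolding run_def using exec_Skip[of s] by auto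
next
  case (Store x i j a)
  then show ?case unfolding run_def using exec_Store[of x i j a s]
    unfolding result.simps cost_bound.simps by blast
next
  case (Seq c d)
  have "run c s (cost_bound c) (\<lambda>s'. s' = result c s)" using Seq by simp
  moreover have "run d s' (cost_bound d) Q" if "s' = result c s" for s' using Seq that by simp
  ultimately show ?case using run_Seq by fastforce
next
  case (If b c d)
  have "run (com.If b c d) s (1 + bcost b + max (cost_bound c) (cost_bound d)) Q"
  proof (rule run_If)
    assume "bval b s"
    then have "run c s (cost_bound c) Q" using If by simp
    then show "run c s (max (cost_bound c) (cost_bound d)) Q" by (rule run_mono) simp_all
  next
    assume "\<not> bval b s"
    then have "run d s (cost_bound d) Q" using If by simp
    then show "run d s (max (cost_bound c) (cost_bound d)) Q" by (rule run_mono) simp_all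
  qed
  then show ?case by simp
qed simp

lemma run_loop_free:
  "loop_free c \<Longrightarrow> cost_bound c \<le> T \<Longrightarrow> Q (result c s) \<Longrightarrow> run c s T Q"
  by (rule run_mono[OF run_loop_free_cost_bound])

primrec written :: "com \<Rightarrow> string set" where
  "written Skip = {}"
| "written (Store x i j a) = {x}"
| "written (c ;; d) = written c \<union> written d"
| "written (If b c d) = written c \<union> written d"
| "written (While b c) = written c"

lemma written_For [simp]: "written (For x a c) = insert x (written c)"
  by (auto simp: For_def)

lemma exec_unwritten: "exec c s t s' \<Longrightarrow> x \<notin> written c \<Longrightarrow> s' (x, i, j) = s (x, i, j)"
  by (induction rule: exec.induct) auto

text \<open>A frame rule: invariants need to mention only what a command changes. It works per array
  name, not per cell.\<close>

lemma run_unwritten: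
  assumes "run c s T Q"
  shows "run c s T (\<lambda>s'. Q s' \<and> (\<forall>x i j. x \<notin> written c \<longrightarrow> s' (x, i, j) = s (x, i, j)))"
  using assms exec_unwritten unfolding run_def by meson

text \<open>A test \<open>Less (Var x) (Var y)\<close> costs 8, an increment of the loop variable 8, and its
  initialisation 4. This gives 16 per iteration and 12 once.\<close>

lemma run_For_from:
  assumes "I i (s((x, 0, 0) := i))" "s (x, 0, 0) = i" "s (y, 0, 0) = m" "i \<le> m" "x \<noteq> y"
    and "x \<notin> written c" "y \<notin> written c"
    and step: "\<And>i s. i < m \<Longrightarrow> I i s \<Longrightarrow> s (x, 0, 0) = i \<Longrightarrow> s (y, 0, 0) = m \<Longrightarrow>
      run c s T (\<lambda>s'. I (Suc i) (s'((x, 0, 0) := Suc i)))"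
  shows "run (While (Less (Var x) (Var y)) (c ;; SetVar x (Plus (Var x) (N 1)))) s
    (8 + (m - i) * (16 + T)) (I m)"
  using assms(1-4)
proof (induction "m - i" arbitrary: i s)
  case 0
  let ?b = "Less (Var x) (Var y)"
  have "i = m" "\<not> bval ?b s" using 0 by auto
  moreover have "s((x, 0, 0) := i) = s" using \<open>s (x, 0, 0) = i\<close> by auto
  ultimately show ?case
    using exec_WhileFalse[of ?b s] 0 unfolding run_def by fastforce
next
  case (Suc k)
  let ?b = "Less (Var x) (Var y)" and ?inc = "SetVar x (Plus (Var x) (N 1))"
  have "i < m" using Suc by simp
  then have b: "bval ?b s" using Suc.prems by simp
  have "s((x, 0, 0) := i) = s" using \<open>s (x, 0, 0) = i\<close> by auto
  then have "run c s T (\<lambda>s'. I (Suc i) (s'((x, 0, 0) := Suc i)))"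
    using step[OF \<open>i < m\<close>, of s] Suc.prems by simp
  from run_unwritten[OF this] obtain t1 s1 where 1: "exec c s t1 s1" "t1 \<le> T"
      "I (Suc i) (s1((x, 0, 0) := Suc i))" "s1 (x, 0, 0) = i" "s1 (y, 0, 0) = m"
    unfolding run_def using Suc.prems assms(6,7) by auto
  let ?s2 = "s1((x, 0, 0) := Suc i)"
  have 2: "exec ?inc s1 8 ?s2"
    using exec_Store[of x "N 0" "N 0" "Plus (Var x) (N 1)" s1] 1(4)
    by (simp add: eval_nat_numeral)
  have "run (While ?b (c ;; ?inc)) ?s2 (8 + (m - Suc i) * (16 + T)) (I m)"
    by (rule Suc.hyps(1)) (use Suc.hyps(2) 1 \<open>i < m\<close> \<open>x \<noteq> y\<close> in auto)
  then obtain t3 s3 where 3: "exec (While ?b (c ;; ?inc)) ?s2 t3 s3"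
      "t3 \<le> 8 + (m - Suc i) * (16 + T)" "I m s3"
    unfolding run_def by blast
  have "exec (While ?b (c ;; ?inc)) s (1 + bcost ?b + (t1 + 8) + t3) s3"
    by (rule exec_WhileTrue[OF b exec_Seq[OF 1(1) 2] 3(1)])
  moreover have "1 + bcost ?b + (t1 + 8) + t3 \<le> 8 + (m - i) * (16 + T)"
  proof -
    have "m - i = Suc (m - Suc i)" using \<open>i < m\<close> by simp
    then show ?thesis using 1(2) 3(2) by simp
  qed
  ultimately show ?case unfolding run_def using 3(3) by blast
qed

lemma run_For:
  assumes "I 0 (s((x, 0, 0) := 0))" "s (y, 0, 0) = m" "x \<noteq> y" "m \<le> n"
    and "x \<notin> written c" "y \<notin> written c"
    and "\<And>i s. i < m \<Longrightarrow> I i s \<Longrightarrow> s (x, 0, 0) = i \<Longrightarrow> s (y, 0, 0) = m \<Longrightarrow>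
      run c s T (\<lambda>s'. I (Suc i) (s'((x, 0, 0) := Suc i)))"
  shows "run (For x (Var y) c) s (12 + n * (16 + T)) (I m)"
proof -
  let ?s = "s((x, 0, 0) := 0)"
  have "run (SetVar x (N 0)) s 4 (\<lambda>s'. s' = ?s)"
    by (rule run_loop_free) simp_all
  moreover have "run (While (Less (Var x) (Var y)) (c ;; SetVar x (Plus (Var x) (N 1)))) s'
      (8 + (m - 0) * (16 + T)) (I m)" if "s' = ?s" for s'
    unfolding that
  proof (rule run_For_from[OF _ _ _ _ assms(3,5,6,7)])
    show "I 0 (?s((x, 0, 0) := 0))" unfolding fun_upd_upd by (rule assms(1))
  qed (use assms(2,3) in auto)
  ultimately have "run (For x (Var y) c) s (4 + (8 + (m - 0) * (16 + T))) (I m)"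
    unfolding For_def by (rule run_Seq)
  then show ?thesis by (rule run_mono) (use assms(4) in auto)
qed

section \<open>Correctness and running time of the program\<close>

definition adjacent_at :: "'a list \<Rightarrow> 'a set set \<Rightarrow> nat \<Rightarrow> nat \<Rightarrow> bool" where
  "adjacent_at us E i j \<longleftrightarrow> {us ! i, us ! j} \<in> E"

text \<open>Fixes only the input cells, which the program reads but never writes; hence it survives
  all changes to the working arrays.\<close>

definition presents :: "'a list \<Rightarrow> 'a set set \<Rightarrow> state \<Rightarrow> bool" where
  "presents us E s \<longleftrightarrow> s (''n'', 0, 0) = length us \<and>
     (\<forall>i<length us. \<forall>j<length us. s (''adj'', i, j) = of_bool (adjacent_at us E i j))"

lemma presents_update [simp]:
  "x \<noteq> ''n'' \<Longrightarrow> x \<noteq> ''adj'' \<Longrightarrow> presents us E (s((x, i, j) := a)) \<longleftrightarrow> presents us E s"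
  by (simp add: presents_def)

lemma presents_n: "presents us E s \<Longrightarrow> s (''n'', 0, 0) = length us"
  by (simp add: presents_def)

lemma presents_adj:
  "presents us E s \<Longrightarrow> i < length us \<Longrightarrow> j < length us \<Longrightarrow>
    s (''adj'', i, j) = of_bool (adjacent_at us E i j)"
  by (simp add: presents_def)

text \<open>Neighbours are nodes of \<open>us\<close>, so a loop over indices compares the sets
  completely; as \<open>us\<close> is distinct, removing a node means skipping one index. The two
  disjuncts are what the flags \<open>eq\<close> and \<open>eq_minus\<close> compute.\<close>

lemma twin_nth_iff:
  assumes "distinct us" "simple_graph (set us) E" "i < length us" "j < length us"
  shows "twin E (us ! i) (us ! j) \<longleftrightarrow>
    (\<forall>w<length us. adjacent_at us E i w \<longleftrightarrow> adjacent_at us E j w) \<or>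
    (\<forall>w<length us. (adjacent_at us E i w \<and> w \<noteq> j) \<longleftrightarrow> (adjacent_at us E j w \<and> w \<noteq> i))"
proof -
  have sub: "nbrs E u \<subseteq> set us" for u
    using simple_graph_edgeD[OF assms(2)] by (auto simp: nbrs_def)
  have *: "A = B \<longleftrightarrow> (\<forall>w<length us. us ! w \<in> A \<longleftrightarrow> us ! w \<in> B)"
    if "A \<subseteq> set us" "B \<subseteq> set us" for A B
    using that nth_mem[of _ us] by (fastforce simp: in_set_conv_nth)
  have "nbrs E (us ! i) = nbrs E (us ! j) \<longleftrightarrow>
      (\<forall>w<length us. adjacent_at us E i w \<longleftrightarrow> adjacent_at us E j w)"
    unfolding *[OF sub sub] by (simp add: nbrs_def adjacent_at_def)
  moreover have "nbrs E (us ! i) - {us ! j} = nbrs E (us ! j) - {us ! i} \<longleftrightarrow>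
      (\<forall>w<length us. (adjacent_at us E i w \<and> w \<noteq> j) \<longleftrightarrow> (adjacent_at us E j w \<and> w \<noteq> i))"
    by (subst *) (use sub assms in \<open>auto simp: nbrs_def adjacent_at_def nth_eq_iff_index_eq\<close>)
  ultimately show ?thesis by (simp add: twin_def)
qed

lemma run_compare_nbrs:
  assumes "distinct us" "simple_graph (set us) E" "presents us E s"
    and ij: "s (''u'', 0, 0) = i" "i < length us" "s (''v'', 0, 0) = j" "j < length us"
  shows "run compare_nbrs s (20 + length us * 80)
    (\<lambda>s'. s' (''eq'', 0, 0) = 1 \<or> s' (''eq_minus'', 0, 0) = 1 \<longleftrightarrow> twin E (us ! i) (us ! j))"
proof -
  let ?A = "adjacent_at us E"
  define I where "I m s \<longleftrightarrow> presents us E s \<and> s (''u'', 0, 0) = i \<and> s (''v'', 0, 0) = j \<and>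
    (s (''eq'', 0, 0) = 1 \<longleftrightarrow> (\<forall>w<m. ?A i w \<longleftrightarrow> ?A j w)) \<and>
    (s (''eq_minus'', 0, 0) = 1 \<longleftrightarrow> (\<forall>w<m. (?A i w \<and> w \<noteq> j) \<longleftrightarrow> (?A j w \<and> w \<noteq> i)))"
    for m and s :: state
  let ?init = "s((''eq'', 0, 0) := 1, (''eq_minus'', 0, 0) := 1)"
  \<comment> \<open>The two 4s pay for initialising the flags; 64 is the \<open>cost_bound\<close>
    of the loop body, 21 for the \<open>eq\<close> test and 43 for the \<open>eq_minus\<close>
    test.\<close>
  have "run compare_nbrs s (4 + (4 + (12 + length us * (16 + 64)))) (I (length us))"
    unfolding compare_nbrs_def
  proof (rule run_Seq)
    show "run (SetVar ''eq'' (N 1)) s 4 (\<lambda>s'. s' = s((''eq'', 0, 0) := 1))"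
      by (rule run_loop_free) simp_all
  next
    fix s1 assume s1: "s1 = s((''eq'', 0, 0) := 1)"
    show "run (SetVar ''eq_minus'' (N 1) ;; For ''w'' (Var ''n'')
       (When (Not (Eq (Cell ''adj'' (Var ''u'') (Var ''w'')) (Cell ''adj'' (Var ''v'') (Var ''w''))))
          (SetVar ''eq'' (N 0)) ;;
        When (Not (Iff
                (And (Eq (Cell ''adj'' (Var ''u'') (Var ''w'')) (N 1)) (Not (Eq (Var ''w'') (Var ''v''))))
                (And (Eq (Cell ''adj'' (Var ''v'') (Var ''w'')) (N 1)) (Not (Eq (Var ''w'') (Var ''u''))))))
          (SetVar ''eq_minus'' (N 0)))) s1 (4 + (12 + length us * (16 + 64))) (I (length us))"
      (is "run (_ ;; For _ _ ?body) _ _ _")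
    proof (rule run_Seq)
      show "run (SetVar ''eq_minus'' (N 1)) s1 4 (\<lambda>s'. s' = ?init)"
        unfolding s1 by (rule run_loop_free) simp_all
    next
      fix s2 assume s2: "s2 = ?init"
      show "run (For ''w'' (Var ''n'') ?body) s2 (12 + length us * (16 + 64)) (I (length us))"
      proof (rule run_For)
        show "I 0 (s2((''w'', 0, 0) := 0))" using assms by (simp add: s2 I_def)
        show "s2 (''n'', 0, 0) = length us" using assms by (simp add: s2 presents_n)
      next
        fix m s assume m: "m < length us" and I: "I m s" and w: "s (''w'', 0, 0) = m"
        have adj: "s (''adj'', i, m) = of_bool (?A i m)" "s (''adj'', j, m) = of_bool (?A j m)"
          using I m ij by (simp_all add: I_def presents_adj)
        show "run ?body s 64 (\<lambda>s'. I (Suc m) (s'((''w'', 0, 0) := Suc m)))"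
        proof (rule run_loop_free)
          show "I (Suc m) ((result ?body s)((''w'', 0, 0) := Suc m))"
            using I w adj by (simp add: I_def less_Suc_eq all_conj_distrib) (auto split: if_splits)
        qed simp_all
      qed simp_all
    qed
  qed
  then show ?thesis
    by (rule run_mono) (use twin_nth_iff[OF assms(1,2)] ij in \<open>auto simp: I_def\<close>)
qed

section \<open>Absorbing the twins of one node\<close>

definition absorb_loop :: com where
  "absorb_loop = For ''v'' (Var ''n'')
     (When (Eq (Arr ''mark'' (Var ''v'')) (N 0))
        (compare_nbrs ;;
         When (Or (Eq (Var ''eq'') (N 1)) (Eq (Var ''eq_minus'') (N 1)))
           (SetArr ''cls'' (Var ''v'') (Var ''k'') ;;
            SetArr ''mark'' (Var ''v'') (N 1))))"

lemma written_compare_nbrs [simp]: "written compare_nbrs = {''eq'', ''eq_minus'', ''w''}"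
  by (auto simp: compare_nbrs_def)

lemma written_absorb_loop [simp]:
  "written absorb_loop = {''v'', ''eq'', ''eq_minus'', ''w'', ''cls'', ''mark''}"
  by (auto simp: absorb_loop_def)

lemma run_absorb_loop:
  assumes "distinct us" "simple_graph (set us) E" "presents us E s"
    and i: "s (''u'', 0, 0) = i" "i < length us"
  defines "n \<equiv> length us" and "tw \<equiv> \<lambda>j. twin E (us ! i) (us ! j)"
  shows "run absorb_loop s (12 + n * (16 + (54 + n * 80))) (\<lambda>s'. \<forall>j<n.
    (s' (''mark'', j, 0) \<noteq> 0 \<longleftrightarrow> s (''mark'', j, 0) \<noteq> 0 \<or> tw j) \<and>
    s' (''cls'', j, 0) =
      (if s (''mark'', j, 0) = 0 \<and> tw j then s (''k'', 0, 0) else s (''cls'', j, 0)))"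
proof -
  define I where "I m t \<longleftrightarrow> presents us E t \<and> t (''u'', 0, 0) = i \<and> t (''k'', 0, 0) = s (''k'', 0, 0) \<and>
    (\<forall>j<n. (t (''mark'', j, 0) \<noteq> 0 \<longleftrightarrow> s (''mark'', j, 0) \<noteq> 0 \<or> (j < m \<and> tw j)) \<and>
      t (''cls'', j, 0) =
        (if s (''mark'', j, 0) = 0 \<and> j < m \<and> tw j then s (''k'', 0, 0) else s (''cls'', j, 0)))"
    for m and t :: state
  have "run absorb_loop s (12 + n * (16 + (54 + n * 80))) (I n)"
    unfolding absorb_loop_def
  proof (rule run_For)
    show "I 0 (s((''v'', 0, 0) := 0))" using assms by (simp add: I_def)
    show "s (''n'', 0, 0) = n" using assms by (simp add: presents_n)
  next
    fix m t assume m: "m < n" and I: "I m t" and v: "t (''v'', 0, 0) = m"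
    let ?Q = "\<lambda>s'. I (Suc m) (s'((''v'', 0, 0) := Suc m))"
    let ?add = "When (Or (Eq (Var ''eq'') (N 1)) (Eq (Var ''eq_minus'') (N 1)))
        (SetArr ''cls'' (Var ''v'') (Var ''k'') ;; SetArr ''mark'' (Var ''v'') (N 1))"
    \<comment> \<open>The mark test costs 8, the comparison \<open>20 + n * 80\<close> and
      \<open>?add\<close> at most 26, which gives the 54 of the loop bound.\<close>
    have "run (When (Eq (Arr ''mark'' (Var ''v'')) (N 0)) (compare_nbrs ;; ?add)) t
        (1 + bcost (Eq (Arr ''mark'' (Var ''v'')) (N 0)) + ((20 + n * 80) + 26)) ?Q"
    proof (rule run_If)
      assume "bval (Eq (Arr ''mark'' (Var ''v'')) (N 0)) t"
      then have unmarked: "t (''mark'', m, 0) = 0" using v by simp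
      show "run (compare_nbrs ;; ?add) t ((20 + n * 80) + 26) ?Q"
      proof (rule run_Seq)
        show "run compare_nbrs t (20 + n * 80) (\<lambda>s'.
            (s' (''eq'', 0, 0) = 1 \<or> s' (''eq_minus'', 0, 0) = 1 \<longleftrightarrow> tw m) \<and>
            (\<forall>x i j. x \<notin> written compare_nbrs \<longrightarrow> s' (x, i, j) = t (x, i, j)))"
          unfolding n_def tw_def
          by (rule run_unwritten[OF run_compare_nbrs[OF assms(1,2)]])
            (use I v m i in \<open>auto simp: I_def n_def\<close>)
      next
        fix s' assume s': "(s' (''eq'', 0, 0) = 1 \<or> s' (''eq_minus'', 0, 0) = 1 \<longleftrightarrow> tw m) \<and>
            (\<forall>x i j. x \<notin> written compare_nbrs \<longrightarrow> s' (x, i, j) = t (x, i, j))"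
        then have frame: "s' (x, i, j) = t (x, i, j)" if "x \<notin> {''eq'', ''eq_minus'', ''w''}" for x i j
          using that by simp
        have pres: "presents us E s'" using I frame by (simp add: I_def presents_def)
        show "run ?add s' 26 ?Q"
        proof (rule run_loop_free)
          show "I (Suc m) ((result ?add s')((''v'', 0, 0) := Suc m))"
            using I v m s' pres unmarked by (auto simp: I_def frame less_Suc_eq)
        qed simp_all
      qed
    next
      assume "\<not> bval (Eq (Arr ''mark'' (Var ''v'')) (N 0)) t"
      then have marked: "t (''mark'', m, 0) \<noteq> 0" using v by simp
      show "run Skip t ((20 + n * 80) + 26) ?Q"
      proof (rule run_loop_free)
        \<comment> \<open>Iteration \<open>m\<close> is the only one that can change the mark of
          node \<open>m\<close>, so the mark found now was already there before the loop.\<close>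
        have "s (''mark'', m, 0) \<noteq> 0" using I m marked by (auto simp: I_def)
        then show "I (Suc m) ((result Skip t)((''v'', 0, 0) := Suc m))"
          using I by (auto simp: I_def less_Suc_eq)
      qed simp_all
    qed
    then show "run (When (Eq (Arr ''mark'' (Var ''v'')) (N 0)) (compare_nbrs ;; ?add)) t (54 + n * 80) ?Q"
      by (rule run_mono) simp_all
  qed simp_all
  then show ?thesis by (rule run_mono) (auto simp: I_def)
qed

section \<open>The supernode phase\<close>

text \<open>Unmarked nodes have \<open>cls = 0\<close> like the members of the first supernode, so before the program
  ends \<open>stored_supernode\<close> must be restricted to marked nodes.\<close>

definition marked_supernode :: "'a list \<Rightarrow> state \<Rightarrow> nat \<Rightarrow> 'a set" where
  "marked_supernode us s a =
     {us ! j |j. j < length us \<and> s (''mark'', j, 0) \<noteq> 0 \<and> s (''cls'', j, 0) = a}"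

text \<open>\<open>M\<close> and the partial run over the first \<open>m\<close> nodes are ghosts:
  the recorded supernodes are read off the arrays. That used labels lie below \<open>k\<close> makes
  \<open>k\<close> a fresh label for the next supernode; that every label below \<open>k\<close> is
  in use later gives distinct supernodes and \<open>k \<le> length us\<close>; that visited nodes
  are marked makes \<open>marked_supernode\<close> and \<open>stored_supernode\<close> agree at the
  end.\<close>

definition supernodes_inv :: "'a list \<Rightarrow> 'a set set \<Rightarrow> nat \<Rightarrow> state \<Rightarrow> bool" where
  "supernodes_inv us E m s \<longleftrightarrow> presents us E s \<and>
     (\<exists>M. for_each (visit (set us) E) (set (take m us)) ({}, {})
            (M, marked_supernode us s ` {..<s (''k'', 0, 0)}) \<and>
          (\<forall>j<length us. s (''mark'', j, 0) \<noteq> 0 \<longleftrightarrow> us ! j \<in> M)) \<and>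
     (\<forall>j<length us. s (''mark'', j, 0) \<noteq> 0 \<longrightarrow> s (''cls'', j, 0) < s (''k'', 0, 0)) \<and>
     (\<forall>a<s (''k'', 0, 0). \<exists>j<length us. s (''mark'', j, 0) \<noteq> 0 \<and> s (''cls'', j, 0) = a) \<and>
     (\<forall>j<m. s (''mark'', j, 0) \<noteq> 0)"

lemma supernodes_inv_cong:
  assumes "supernodes_inv us E m s"
    and "\<And>x i j. x \<in> {''n'', ''adj'', ''k'', ''mark'', ''cls''} \<Longrightarrow> s' (x, i, j) = s (x, i, j)"
  shows "supernodes_inv us E m s'"
proof -
  have eq: "s' (''n'', i, j) = s (''n'', i, j)" "s' (''adj'', i, j) = s (''adj'', i, j)"
    "s' (''k'', i, j) = s (''k'', i, j)" "s' (''mark'', i, j) = s (''mark'', i, j)"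
    "s' (''cls'', i, j) = s (''cls'', i, j)" for i j
    using assms(2) by simp_all
  have eqs: "presents us E s' = presents us E s" "marked_supernode us s' = marked_supernode us s"
    unfolding presents_def marked_supernode_def eq by (rule refl)+
  show ?thesis using assms(1) unfolding supernodes_inv_def eq eqs .
qed

lemma supernodes_inv_marked:
  assumes "distinct us" "supernodes_inv us E m s" "m < length us" "s (''mark'', m, 0) \<noteq> 0"
  shows "supernodes_inv us E (Suc m) s"
proof -
  let ?R = "marked_supernode us s ` {..<s (''k'', 0, 0)}"
  obtain M where M: "for_each (visit (set us) E) (set (take m us)) ({}, {}) (M, ?R)"
      "\<forall>j<length us. s (''mark'', j, 0) \<noteq> 0 \<longleftrightarrow> us ! j \<in> M"
    using assms(2) unfolding supernodes_inv_def by blast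
  have "us ! m \<notin> set (take m us)" using assms(1,3)
    by (auto simp: in_set_conv_nth nth_eq_iff_index_eq)
  moreover have "visit (set us) E (us ! m) (M, ?R) (M, ?R)" using M(2) assms(3,4) by simp
  ultimately have "for_each (visit (set us) E) (set (take (Suc m) us)) ({}, {}) (M, ?R)"
    using for_each_snoc[OF M(1)] assms(3) by (simp add: take_Suc_conv_app_nth)
  then show ?thesis using M(2) assms(2,4) unfolding supernodes_inv_def by (auto simp: less_Suc_eq)
qed

text \<open>All old labels are below the old \<open>k\<close>, so the nodes now labelled
  \<open>k\<close> are exactly those marked in this visit, and no earlier supernode changes. Hence
  the arrays record precisely the set that the abstract \<open>visit\<close> inserts.\<close>

lemma supernodes_inv_new:
  assumes "distinct us" "supernodes_inv us E m s" "m < length us" "s (''mark'', m, 0) = 0"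
    and "presents us E s'" "s' (''k'', 0, 0) = Suc (s (''k'', 0, 0))"
    and mark: "\<And>j. j < length us \<Longrightarrow>
      s' (''mark'', j, 0) \<noteq> 0 \<longleftrightarrow> s (''mark'', j, 0) \<noteq> 0 \<or> twin E (us ! m) (us ! j)"
    and cls: "\<And>j. j < length us \<Longrightarrow> s' (''cls'', j, 0) =
      (if s (''mark'', j, 0) = 0 \<and> twin E (us ! m) (us ! j) then s (''k'', 0, 0)
       else s (''cls'', j, 0))"
  shows "supernodes_inv us E (Suc m) s'"
proof -
  let ?k = "s (''k'', 0, 0)"
  let ?R = "marked_supernode us s ` {..<?k}"
  obtain M where M: "for_each (visit (set us) E) (set (take m us)) ({}, {}) (M, ?R)"
      "\<forall>j<length us. s (''mark'', j, 0) \<noteq> 0 \<longleftrightarrow> us ! j \<in> M"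
    using assms(2) unfolding supernodes_inv_def by blast
  have cls_less: "s (''cls'', j, 0) < ?k" if "j < length us" "s (''mark'', j, 0) \<noteq> 0" for j
    using assms(2) that unfolding supernodes_inv_def by blast
  let ?C = "{v \<in> set us - M. twin E (us ! m) v}"
  have "marked_supernode us s' a = marked_supernode us s a" if "a < ?k" for a
  proof -
    have "j < length us \<and> s' (''mark'', j, 0) \<noteq> 0 \<and> s' (''cls'', j, 0) = a \<longleftrightarrow>
        j < length us \<and> s (''mark'', j, 0) \<noteq> 0 \<and> s (''cls'', j, 0) = a" for j
      using that mark[of j] cls[of j] by (auto split: if_splits)
    then show ?thesis unfolding marked_supernode_def by simp
  qed
  moreover have "marked_supernode us s' ?k = ?C"
  proof -
    have "j < length us \<and> s' (''mark'', j, 0) \<noteq> 0 \<and> s' (''cls'', j, 0) = ?k \<longleftrightarrow>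
        j < length us \<and> us ! j \<notin> M \<and> twin E (us ! m) (us ! j)" for j
      using M(2) mark[of j] cls[of j] cls_less[of j] by (auto split: if_splits)
    then show ?thesis unfolding marked_supernode_def by (auto simp: in_set_conv_nth)
  qed
  ultimately have R': "marked_supernode us s' ` {..<Suc ?k} = insert ?C ?R"
    by (auto simp: lessThan_Suc)
  have "us ! m \<notin> set (take m us)" using assms(1,3)
    by (auto simp: in_set_conv_nth nth_eq_iff_index_eq)
  moreover have "visit (set us) E (us ! m) (M, ?R) (M \<union> ?C, insert ?C ?R)"
    by (subst visit_iff) (use M(2) assms(3,4) in auto)
  ultimately have "for_each (visit (set us) E) (set (take (Suc m) us)) ({}, {}) (M \<union> ?C, insert ?C ?R)"
    using for_each_snoc[OF M(1)] assms(3) by (simp add: take_Suc_conv_app_nth)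
  moreover have "\<forall>j<length us. s' (''mark'', j, 0) \<noteq> 0 \<longleftrightarrow> us ! j \<in> M \<union> ?C"
    using mark M(2) by auto
  moreover have "\<forall>j<length us. s' (''mark'', j, 0) \<noteq> 0 \<longrightarrow> s' (''cls'', j, 0) < Suc ?k"
  proof (intro allI impI)
    fix j assume "j < length us" "s' (''mark'', j, 0) \<noteq> 0"
    then show "s' (''cls'', j, 0) < Suc ?k"
      using mark[of j] cls[of j] cls_less[of j] by (auto split: if_splits)
  qed
  moreover have "\<exists>j<length us. s' (''mark'', j, 0) \<noteq> 0 \<and> s' (''cls'', j, 0) = a" if "a < Suc ?k" for a
  proof (cases "a = ?k")
    case True
    \<comment> \<open>The witness for the new label is node \<open>m\<close>, which is its own
      twin.\<close>
    then show ?thesis using mark[of m] cls[of m] assms(3,4) by auto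
  next
    case False
    then have "a < ?k" using that by simp
    then obtain j where "j < length us" "s (''mark'', j, 0) \<noteq> 0" "s (''cls'', j, 0) = a"
      using assms(2) unfolding supernodes_inv_def by blast
    then show ?thesis using mark[of j] cls[of j] by auto
  qed
  moreover have "\<forall>j<Suc m. s' (''mark'', j, 0) \<noteq> 0"
  proof (intro allI impI)
    fix j assume "j < Suc m"
    then have "j = m \<or> s (''mark'', j, 0) \<noteq> 0" using assms(2) unfolding supernodes_inv_def by (auto simp: less_Suc_eq)
    then show "s' (''mark'', j, 0) \<noteq> 0" using mark[of j] \<open>j < Suc m\<close> assms(3) by auto
  qed
  ultimately show ?thesis
    unfolding supernodes_inv_def assms(6) R' using assms(5) by blast
qed

lemma run_build_supernodes_step:
  assumes "distinct us" "simple_graph (set us) E" "supernodes_inv us E m s"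
    and m: "m < length us" "s (''u'', 0, 0) = m" and unmarked: "s (''mark'', m, 0) = 0"
  shows "run (SetArr ''cls'' (Var ''u'') (Var ''k'') ;; SetArr ''mark'' (Var ''u'') (N 1) ;;
      absorb_loop ;; SetVar ''k'' (Plus (Var ''k'') (N 1))) s
    (34 + length us * (70 + length us * 80))
    (\<lambda>s'. supernodes_inv us E (Suc m) s')"
proof -
  let ?n = "length us"
  let ?k = "s (''k'', 0, 0)"
  let ?s1 = "s((''cls'', m, 0) := ?k, (''mark'', m, 0) := 1)"
  let ?tw = "\<lambda>j. twin E (us ! m) (us ! j)"
  have pres: "presents us E ?s1" using assms(3) by (simp add: supernodes_inv_def)
  let ?P = "\<lambda>s'. (\<forall>j<?n.
      (s' (''mark'', j, 0) \<noteq> 0 \<longleftrightarrow> ?s1 (''mark'', j, 0) \<noteq> 0 \<or> ?tw j) \<and>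
      s' (''cls'', j, 0) =
        (if ?s1 (''mark'', j, 0) = 0 \<and> ?tw j then ?s1 (''k'', 0, 0) else ?s1 (''cls'', j, 0))) \<and>
      (\<forall>x i j. x \<notin> written absorb_loop \<longrightarrow> s' (x, i, j) = ?s1 (x, i, j))"
  have "run (SetArr ''cls'' (Var ''u'') (Var ''k'') ;; SetArr ''mark'' (Var ''u'') (N 1) ;;
      absorb_loop ;; SetVar ''k'' (Plus (Var ''k'') (N 1))) s
    (8 + (6 + ((12 + ?n * (16 + (54 + ?n * 80))) + 8))) (supernodes_inv us E (Suc m))"
  proof (intro run_Seq)
    show "run (SetArr ''cls'' (Var ''u'') (Var ''k'')) s 8 (\<lambda>t. t = s((''cls'', m, 0) := ?k))"
      by (rule run_loop_free) (simp_all add: m)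
  next
    show "run (SetArr ''mark'' (Var ''u'') (N 1)) t 6 (\<lambda>t. t = ?s1)"
      if "t = s((''cls'', m, 0) := ?k)" for t
      by (rule run_loop_free) (simp_all add: m that)
  next
    show "run absorb_loop t (12 + ?n * (16 + (54 + ?n * 80))) ?P" if "t = ?s1" for t
      unfolding that
      by (rule run_unwritten[OF run_absorb_loop[OF assms(1,2) pres]]) (simp_all add: m)
  next
    fix s' assume P: "?P s'"
    then have frame: "s' (x, i, j) = ?s1 (x, i, j)"
      if "x \<notin> {''v'', ''eq'', ''eq_minus'', ''w'', ''cls'', ''mark''}" for x i j
      using that by simp
    let ?s2 = "s'((''k'', 0, 0) := Suc ?k)"
    show "run (SetVar ''k'' (Plus (Var ''k'') (N 1))) s' 8 (supernodes_inv us E (Suc m))"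
    proof (rule run_loop_free)
      have "supernodes_inv us E (Suc m) ?s2"
      proof (rule supernodes_inv_new[OF assms(1,3) m(1) unmarked])
        show "presents us E ?s2" using pres frame by (simp add: presents_def)
        fix j assume j: "j < length us"
        \<comment> \<open>Node \<open>m\<close> is marked before the absorbing loop starts, so for
          the loop it is an old node, while relative to \<open>s\<close> it is a newly marked twin
          of itself; hence the case split on \<open>j = m\<close>.\<close>
        show "?s2 (''mark'', j, 0) \<noteq> 0 \<longleftrightarrow> s (''mark'', j, 0) \<noteq> 0 \<or> ?tw j"
          using P j by (cases "j = m") auto
        show "?s2 (''cls'', j, 0) =
            (if s (''mark'', j, 0) = 0 \<and> ?tw j then ?k else s (''cls'', j, 0))"
          using P j unmarked by (cases "j = m") auto
      qed simp
      then show "supernodes_inv us E (Suc m) (result (SetVar ''k'' (Plus (Var ''k'') (N 1))) s')"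
        by (simp add: frame)
    qed simp_all
  qed
  then show ?thesis by (rule run_mono) simp_all
qed

text \<open>The interface of the first phase: the run serves correctness, the cardinality the
  decision problem, and \<open>k \<le> length us\<close> the time bound of the superedge
  loops.\<close>

definition supernodes_built :: "'a list \<Rightarrow> 'a set set \<Rightarrow> state \<Rightarrow> bool" where
  "supernodes_built us E s \<longleftrightarrow> presents us E s \<and>
     (\<exists>M. for_each (visit (set us) E) (set us) ({}, {})
            (M, stored_supernode us s ` {..<s (''k'', 0, 0)})) \<and>
     card (stored_supernode us s ` {..<s (''k'', 0, 0)}) = s (''k'', 0, 0) \<and>
     s (''k'', 0, 0) \<le> length us"

lemma supernodes_built_if_inv:
  assumes "distinct us" "supernodes_inv us E (length us) s"
  shows "supernodes_built us E s"
proof -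
  let ?n = "length us" and ?k = "s (''k'', 0, 0)"
  have marked: "s (''mark'', j, 0) \<noteq> 0" if "j < ?n" for j
    using assms(2) that unfolding supernodes_inv_def by blast
  then have eq: "marked_supernode us s = stored_supernode us s"
    unfolding marked_supernode_def stored_supernode_def by (intro ext) blast
  have wit: "\<exists>j<?n. s (''cls'', j, 0) = a" if "a < ?k" for a
    using assms(2) that unfolding supernodes_inv_def by blast
  \<comment> \<open>A label in use can be recovered from its supernode: a common member has a unique
    index in the distinct list \<open>us\<close>, and one index carries one label.\<close>
  have "inj_on (stored_supernode us s) {..<?k}"
  proof (rule inj_onI)
    fix a b assume ab: "a \<in> {..<?k}" "b \<in> {..<?k}" "stored_supernode us s a = stored_supernode us s b"
    then obtain j where j: "j < ?n" "s (''cls'', j, 0) = a" using wit[of a] by blast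
    then have "us ! j \<in> stored_supernode us s a" unfolding stored_supernode_def by blast
    then have "us ! j \<in> stored_supernode us s b" using ab(3) by blast
    then obtain l where l: "us ! j = us ! l" "l < ?n" "s (''cls'', l, 0) = b"
      unfolding stored_supernode_def by blast
    then have "j = l" using nth_eq_iff_index_eq[OF assms(1) j(1) l(2)] by blast
    then show "a = b" using j(2) l(3) by blast
  qed
  then have "card (stored_supernode us s ` {..<?k}) = ?k" by (simp add: card_image)
  moreover have "?k \<le> ?n"
  proof -
    have "{..<?k} \<subseteq> (\<lambda>j. s (''cls'', j, 0)) ` {..<?n}" using wit by fastforce
    then show ?thesis using surj_card_le[of "{..<?n}" "{..<?k}"] by simp
  qed
  moreover have "\<exists>M. for_each (visit (set us) E) (set us) ({}, {}) (M, stored_supernode us s ` {..<?k})"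
    using assms(2) unfolding supernodes_inv_def eq by auto
  moreover have "presents us E s" using assms(2) by (simp add: supernodes_inv_def)
  ultimately show ?thesis unfolding supernodes_built_def by blast
qed

lemma run_build_supernodes:
  assumes us: "distinct us" "simple_graph (set us) E" "presents us E s"
    and "\<And>j. s (''mark'', j, 0) = 0"
  shows "run build_supernodes s (16 + length us * (60 + length us * (70 + length us * 80)))
    (supernodes_built us E)"
proof -
  let ?n = "length us"
  let ?I = "supernodes_inv us E"
  let ?new = "SetArr ''cls'' (Var ''u'') (Var ''k'') ;; SetArr ''mark'' (Var ''u'') (N 1) ;;
      absorb_loop ;; SetVar ''k'' (Plus (Var ''k'') (N 1))"
  let ?body = "When (Eq (Arr ''mark'' (Var ''u'')) (N 0)) ?new"
  let ?s0 = "s((''k'', 0, 0) := 0)"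
  have "run (SetVar ''k'' (N 0) ;; For ''u'' (Var ''n'') ?body) s
      (4 + (12 + ?n * (16 + (8 + (34 + ?n * (70 + ?n * 80)))))) (?I ?n)"
  proof (rule run_Seq)
    show "run (SetVar ''k'' (N 0)) s 4 (\<lambda>t. t = ?s0)"
      by (rule run_loop_free) simp_all
  next
    fix t assume t: "t = ?s0"
    show "run (For ''u'' (Var ''n'') ?body) t (12 + ?n * (16 + (8 + (34 + ?n * (70 + ?n * 80))))) (?I ?n)"
    proof (rule run_For)
      have "for_each (visit (set us) E) {} ({}, {}) ({}, {})" by (rule for_each_empty)
      then show "?I 0 (t((''u'', 0, 0) := 0))"
        using assms by (auto simp: t supernodes_inv_def)
      show "t (''n'', 0, 0) = ?n" using us(3) by (simp add: t presents_n)
    next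
      fix m s assume m: "m < ?n" and I: "?I m s" and u: "s (''u'', 0, 0) = m"
      let ?Q = "\<lambda>s'. ?I (Suc m) (s'((''u'', 0, 0) := Suc m))"
      have upd: "?Q s'" if "?I (Suc m) s'" for s'
        by (rule supernodes_inv_cong[OF that]) auto
      have "run ?body s (1 + bcost (Eq (Arr ''mark'' (Var ''u'')) (N 0)) +
          (34 + ?n * (70 + ?n * 80))) ?Q"
      proof (rule run_If)
        assume "bval (Eq (Arr ''mark'' (Var ''u'')) (N 0)) s"
        then have "s (''mark'', m, 0) = 0" using u by simp
        from run_build_supernodes_step[OF us(1,2) I m u this]
        show "run ?new s (34 + ?n * (70 + ?n * 80)) ?Q"
          by (rule run_mono) (use upd in simp_all)
      next
        assume "\<not> bval (Eq (Arr ''mark'' (Var ''u'')) (N 0)) s"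
        then have "s (''mark'', m, 0) \<noteq> 0" using u by simp
        then have "?I (Suc m) s" using supernodes_inv_marked us(1) I m by blast
        then show "run Skip s (34 + ?n * (70 + ?n * 80)) ?Q"
          by (intro run_loop_free) (use upd in simp_all)
      qed
      then show "run ?body s (8 + (34 + ?n * (70 + ?n * 80))) ?Q"
        by (rule run_mono) simp_all
    qed simp_all
  qed
  moreover have "build_supernodes = SetVar ''k'' (N 0) ;; For ''u'' (Var ''n'') ?body"
    by (simp add: build_supernodes_def absorb_loop_def)
  ultimately have "run build_supernodes s
      (4 + (12 + ?n * (16 + (8 + (34 + ?n * (70 + ?n * 80)))))) (?I ?n)"
    by simp
  then show ?thesis
    by (rule run_mono) (use supernodes_built_if_inv us(1) in simp_all)
qed

lemma written_build_supernodes [simp]: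
  "written build_supernodes =
    {''k'', ''u'', ''cls'', ''mark'', ''v'', ''eq'', ''eq_minus'', ''w''}"
  by (auto simp: build_supernodes_def)

section \<open>The superedge phase\<close>

text \<open>\<open>D\<close> collects the quadruples of loop variables treated so far and
  \<open>s0\<close> is the state at the start of the phase. With \<open>D\<close> arbitrary, one
  invariant serves all four nested loops, each level adding a product set to
  \<open>D\<close>.\<close>

definition superedges_inv :: "state \<Rightarrow> (nat \<times> nat \<times> nat \<times> nat) set \<Rightarrow> state \<Rightarrow> bool" where
  "superedges_inv s0 D s \<longleftrightarrow>
     (\<forall>x i j. x \<notin> {''a'', ''b'', ''u'', ''v'', ''sedge''} \<longrightarrow> s (x, i, j) = s0 (x, i, j)) \<and>
     (\<forall>a b. s (''sedge'', a, b) = 1 \<longleftrightarrow>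
        (\<exists>u v. (a, b, u, v) \<in> D \<and> s0 (''cls'', u, 0) = a \<and> s0 (''cls'', v, 0) = b \<and>
          s0 (''adj'', u, v) = 1))"

lemma superedges_inv_frame:
  "superedges_inv s0 D s \<Longrightarrow> x \<notin> {''a'', ''b'', ''u'', ''v'', ''sedge''} \<Longrightarrow> s (x, i, j) = s0 (x, i, j)"
  unfolding superedges_inv_def by blast

lemma superedges_inv_insert:
  assumes "superedges_inv s0 D s"
  shows "superedges_inv s0 (insert (a, b, u, v) D)
    (if s0 (''cls'', u, 0) = a \<and> s0 (''cls'', v, 0) = b \<and> s0 (''adj'', u, v) = 1
     then s((''sedge'', a, b) := 1) else s)"
    (is "superedges_inv s0 ?D ?s'")
  unfolding superedges_inv_def
proof (intro conjI allI impI)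
  fix x i j assume "x \<notin> {''a'', ''b'', ''u'', ''v'', ''sedge''}"
  then have "?s' (x, i, j) = s (x, i, j)" by auto
  then show "?s' (x, i, j) = s0 (x, i, j)"
    using superedges_inv_frame[OF assms] \<open>x \<notin> _\<close> by metis
next
  fix a' b'
  let ?hit = "\<lambda>a b u v. s0 (''cls'', u, 0) = a \<and> s0 (''cls'', v, 0) = b \<and> s0 (''adj'', u, v) = 1"
  have "?s' (''sedge'', a', b') = 1 \<longleftrightarrow>
      s (''sedge'', a', b') = 1 \<or> (a' = a \<and> b' = b \<and> ?hit a b u v)"
    by (cases "a' = a"; cases "b' = b"; cases "?hit a b u v"; auto)
  also have "s (''sedge'', a', b') = 1 \<longleftrightarrow> (\<exists>u v. (a', b', u, v) \<in> D \<and> ?hit a' b' u v)"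
    using assms unfolding superedges_inv_def by (elim conjE) (erule allE, erule allE, assumption)
  finally show "?s' (''sedge'', a', b') = 1 \<longleftrightarrow> (\<exists>u v. (a', b', u, v) \<in> ?D \<and> ?hit a' b' u v)"
    unfolding insert_iff prod.inject by blast
qed

lemma superedges_inv_update [simp]:
  "x \<in> {''a'', ''b'', ''u'', ''v''} \<Longrightarrow>
    superedges_inv s0 D (s((x, i, j) := m)) \<longleftrightarrow> superedges_inv s0 D s"
proof -
  assume x: "x \<in> {''a'', ''b'', ''u'', ''v''}"
  have "(s((x, i, j) := m)) (''sedge'', a, b) = s (''sedge'', a, b)" for a b
    using x by auto
  moreover have "(s((x, i, j) := m)) (y, a, b) = s (y, a, b)"
    if "y \<notin> {''a'', ''b'', ''u'', ''v'', ''sedge''}" for y a b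
    using x that by auto
  ultimately show ?thesis unfolding superedges_inv_def by presburger
qed

definition superedge_body :: com where
  "superedge_body =
     When (And (And (Eq (Arr ''cls'' (Var ''u'')) (Var ''a'')) (Eq (Arr ''cls'' (Var ''v'')) (Var ''b'')))
               (Eq (Cell ''adj'' (Var ''u'') (Var ''v'')) (N 1)))
       (Store ''sedge'' (Var ''a'') (Var ''b'') (N 1))"

lemma written_superedge_body [simp]: "written superedge_body = {''sedge''}"
  by (simp add: superedge_body_def)

lemma run_superedge_body:
  assumes "superedges_inv s0 D s"
    and "s (''a'', 0, 0) = a" "s (''b'', 0, 0) = b" "s (''u'', 0, 0) = u" "s (''v'', 0, 0) = v"
  shows "run superedge_body s 38 (superedges_inv s0 (insert (a, b, u, v) D))"
  unfolding superedge_body_def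
proof (rule run_loop_free)
  let ?s' = "result (When (And (And (Eq (Arr ''cls'' (Var ''u'')) (Var ''a''))
    (Eq (Arr ''cls'' (Var ''v'')) (Var ''b''))) (Eq (Cell ''adj'' (Var ''u'') (Var ''v'')) (N 1)))
       (Store ''sedge'' (Var ''a'') (Var ''b'') (N 1))) s"
  let ?hit = "s0 (''cls'', u, 0) = a \<and> s0 (''cls'', v, 0) = b \<and> s0 (''adj'', u, v) = 1"
  have "?s' = (if ?hit then s((''sedge'', a, b) := 1) else s)"
    using assms(2-5) by (simp add: superedges_inv_frame[OF assms(1)])
  then show "superedges_inv s0 (insert (a, b, u, v) D) ?s'"
    using superedges_inv_insert[OF assms(1)] by (simp only:)
qed simp_all

lemma run_superedges_v:
  assumes "superedges_inv s0 D s" "s0 (''n'', 0, 0) = n"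
    and "s (''a'', 0, 0) = a" "s (''b'', 0, 0) = b" "s (''u'', 0, 0) = u"
  shows "run (For ''v'' (Var ''n'') superedge_body) s (12 + n * 54)
    (superedges_inv s0 (D \<union> {a} \<times> {b} \<times> {u} \<times> {..<n}))"
proof -
  let ?D = "\<lambda>m. D \<union> {a} \<times> {b} \<times> {u} \<times> {..<m}"
  let ?fix = "\<lambda>s. s (''a'', 0, 0) = a \<and> s (''b'', 0, 0) = b \<and> s (''u'', 0, 0) = u"
  let ?I = "\<lambda>m s. superedges_inv s0 (?D m) s \<and> ?fix s"
  have "run (For ''v'' (Var ''n'') superedge_body) s (12 + n * (16 + 38)) (?I n)"
  proof (rule run_For[where I = ?I])
    show "?I 0 (s((''v'', 0, 0) := 0))" using assms by simp
    show "s (''n'', 0, 0) = n" using superedges_inv_frame[OF assms(1)] assms(2) by simp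
  next
    fix m s assume I: "?I m s" and v: "s (''v'', 0, 0) = m"
    have "insert (a, b, u, m) (?D m) = ?D (Suc m)" by auto
    then have "run superedge_body s 38 (superedges_inv s0 (?D (Suc m)))"
      using run_superedge_body[of s0 "?D m" s a b u m] I v by simp
    from run_unwritten[OF this]
    show "run superedge_body s 38 (\<lambda>s'. ?I (Suc m) (s'((''v'', 0, 0) := Suc m)))"
      by (rule run_mono) (use I in auto)
  qed simp_all
  then show ?thesis by (rule run_mono) simp_all
qed

lemma run_superedges_u:
  assumes "superedges_inv s0 D s" "s0 (''n'', 0, 0) = n"
    and "s (''a'', 0, 0) = a" "s (''b'', 0, 0) = b"
  shows "run (For ''u'' (Var ''n'') (For ''v'' (Var ''n'') superedge_body)) s
    (12 + n * (28 + n * 54))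
    (superedges_inv s0 (D \<union> {a} \<times> {b} \<times> {..<n} \<times> {..<n}))"
proof -
  let ?D = "\<lambda>m. D \<union> {a} \<times> {b} \<times> {..<m} \<times> {..<n}"
  let ?fix = "\<lambda>s. s (''a'', 0, 0) = a \<and> s (''b'', 0, 0) = b"
  let ?I = "\<lambda>m s. superedges_inv s0 (?D m) s \<and> ?fix s"
  let ?c = "For ''v'' (Var ''n'') superedge_body"
  have "run (For ''u'' (Var ''n'') ?c) s (12 + n * (16 + (12 + n * 54))) (?I n)"
  proof (rule run_For[where I = ?I])
    show "?I 0 (s((''u'', 0, 0) := 0))" using assms by simp
    show "s (''n'', 0, 0) = n" using superedges_inv_frame[OF assms(1)] assms(2) by simp
  next
    fix m s assume I: "?I m s" and u: "s (''u'', 0, 0) = m"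
    have "?D m \<union> {a} \<times> {b} \<times> {m} \<times> {..<n} = ?D (Suc m)" by auto
    then have "run ?c s (12 + n * 54) (superedges_inv s0 (?D (Suc m)))"
      using run_superedges_v[of s0 "?D m" s n a b m] I u assms(2) by simp
    from run_unwritten[OF this]
    show "run ?c s (12 + n * 54) (\<lambda>s'. ?I (Suc m) (s'((''u'', 0, 0) := Suc m)))"
      by (rule run_mono) (use I in auto)
  qed simp_all
  then show ?thesis by (rule run_mono) simp_all
qed

lemma run_superedges_b:
  assumes "superedges_inv s0 D s" "s0 (''n'', 0, 0) = n" "s0 (''k'', 0, 0) = k" "k \<le> n"
    and "s (''a'', 0, 0) = a"
  shows "run (For ''b'' (Var ''k'') (For ''u'' (Var ''n'') (For ''v'' (Var ''n'') superedge_body))) s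
    (12 + n * (28 + n * (28 + n * 54)))
    (superedges_inv s0 (D \<union> {a} \<times> {..<k} \<times> {..<n} \<times> {..<n}))"
proof -
  let ?D = "\<lambda>m. D \<union> {a} \<times> {..<m} \<times> {..<n} \<times> {..<n}"
  let ?I = "\<lambda>m s. superedges_inv s0 (?D m) s \<and> s (''a'', 0, 0) = a"
  let ?c = "For ''u'' (Var ''n'') (For ''v'' (Var ''n'') superedge_body)"
  have "run (For ''b'' (Var ''k'') ?c) s (12 + n * (16 + (12 + n * (28 + n * 54)))) (?I k)"
  proof (rule run_For[where I = ?I])
    show "?I 0 (s((''b'', 0, 0) := 0))" using assms by simp
    show "s (''k'', 0, 0) = k" using superedges_inv_frame[OF assms(1)] assms(3) by simp
    show "k \<le> n" by fact
  next
    fix m s assume I: "?I m s" and b: "s (''b'', 0, 0) = m"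
    have "?D m \<union> {a} \<times> {m} \<times> {..<n} \<times> {..<n} = ?D (Suc m)" by auto
    then have "run ?c s (12 + n * (28 + n * 54)) (superedges_inv s0 (?D (Suc m)))"
      using run_superedges_u[of s0 "?D m" s n a m] I b assms(2) by simp
    from run_unwritten[OF this]
    show "run ?c s (12 + n * (28 + n * 54)) (\<lambda>s'. ?I (Suc m) (s'((''b'', 0, 0) := Suc m)))"
      by (rule run_mono) (use I in auto)
  qed simp_all
  then show ?thesis by (rule run_mono) simp_all
qed

lemma run_build_superedges:
  assumes "\<And>a b. s (''sedge'', a, b) = 0"
    and "s (''n'', 0, 0) = n" "s (''k'', 0, 0) = k" "k \<le> n"
  shows "run build_superedges s (12 + n * (28 + n * (28 + n * (28 + n * 54))))
    (superedges_inv s ({..<k} \<times> {..<k} \<times> {..<n} \<times> {..<n}))"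
proof -
  let ?D = "\<lambda>m. {..<m} \<times> {..<k} \<times> {..<n} \<times> {..<n}"
  let ?I = "\<lambda>m. superedges_inv s (?D m)"
  let ?c = "For ''b'' (Var ''k'') (For ''u'' (Var ''n'') (For ''v'' (Var ''n'') superedge_body))"
  have "run (For ''a'' (Var ''k'') ?c) s (12 + n * (16 + (12 + n * (28 + n * (28 + n * 54))))) (?I k)"
  proof (rule run_For[where I = ?I])
    \<comment> \<open>No quadruple has been treated, which matches \<open>sedge\<close> being 0
      everywhere initially.\<close>
    have "superedges_inv s (?D 0) s" using assms(1) by (simp add: superedges_inv_def)
    then show "?I 0 (s((''a'', 0, 0) := 0))" by simp
    show "s (''k'', 0, 0) = k" "k \<le> n" by fact+
  next
    fix m t assume I: "?I m t" and a: "t (''a'', 0, 0) = m"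
    have "?D m \<union> {m} \<times> {..<k} \<times> {..<n} \<times> {..<n} = ?D (Suc m)" by auto
    then have "run ?c t (12 + n * (28 + n * (28 + n * 54))) (?I (Suc m))"
      using run_superedges_b[OF I assms(2-4) a] by simp
    then show "run ?c t (12 + n * (28 + n * (28 + n * 54))) (\<lambda>s'. ?I (Suc m) (s'((''a'', 0, 0) := Suc m)))"
      by (rule run_mono) simp_all
  qed simp_all
  moreover have "build_superedges = For ''a'' (Var ''k'') ?c"
    by (simp add: build_superedges_def superedge_body_def)
  ultimately have "run build_superedges s
      (12 + n * (16 + (12 + n * (28 + n * (28 + n * 54))))) (?I k)" by simp
  then show ?thesis by (rule run_mono) simp_all
qed

text \<open>The supernodes come with their run from the first phase; only the superedges need
  comparing. The \<open>sedge\<close> array is indexed by ordered pairs, so each unordered superedge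
  is matched in the order in which its endpoints are given.\<close>

lemma stored_summary_output:
  assumes "supernodes_built us E s"
    and "superedges_inv s ({..<k} \<times> {..<k} \<times> {..<length us} \<times> {..<length us}) s'"
    and "s (''k'', 0, 0) = k"
  shows "algorithm_output (set us) E (stored_summary us s')"
proof -
  let ?n = "length us"
  let ?R = "stored_supernode us s ` {..<k}"
  have st: "stored_supernode us s' = stored_supernode us s"
    unfolding stored_supernode_def using superedges_inv_frame[OF assms(2)] by simp
  have k: "s' (''k'', 0, 0) = k" using superedges_inv_frame[OF assms(2)] assms(3) by simp
  have adj: "s (''adj'', u, v) = 1 \<longleftrightarrow> {us ! u, us ! v} \<in> E" if "u < ?n" "v < ?n" for u v
    using assms(1) presents_adj[OF _ that, of E s] by (simp add: supernodes_built_def adjacent_at_def)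
  have sedge: "s' (''sedge'', a, b) = 1 \<longleftrightarrow>
      (\<exists>x\<in>stored_supernode us s a. \<exists>y\<in>stored_supernode us s b. {x, y} \<in> E)"
    if "a < k" "b < k" for a b
  proof -
    have "s' (''sedge'', a, b) = 1 \<longleftrightarrow> (\<exists>u v. u < ?n \<and> v < ?n \<and> s (''cls'', u, 0) = a \<and>
        s (''cls'', v, 0) = b \<and> s (''adj'', u, v) = 1)"
      using assms(2) that unfolding superedges_inv_def by auto
    also have "\<dots> \<longleftrightarrow> (\<exists>x\<in>stored_supernode us s a. \<exists>y\<in>stored_supernode us s b. {x, y} \<in> E)"
      unfolding stored_supernode_def using adj by blast
    finally show ?thesis .
  qed
  let ?st = "stored_supernode us s"
  have "{{?st a, ?st b} |a b. a < k \<and> b < k \<and> s' (''sedge'', a, b) = 1} = induced_superedges E ?R"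
    (is "?L = _")
  proof (intro equalityI subsetI)
    fix e assume "e \<in> ?L"
    then obtain a b where ab: "e = {?st a, ?st b}" "a < k" "b < k" "s' (''sedge'', a, b) = 1"
      by blast
    have "?st a \<in> ?R" "?st b \<in> ?R" using ab(2,3) by simp_all
    then show "e \<in> induced_superedges E ?R"
      unfolding ab(1) mem_induced_superedges using sedge[OF ab(2,3)] ab(4) by blast
  next
    fix e assume "e \<in> induced_superedges E ?R"
    then obtain S T where e: "e = {S, T}" "S \<in> ?R" "T \<in> ?R" "\<exists>x\<in>S. \<exists>y\<in>T. {x, y} \<in> E"
      unfolding induced_superedges_def by blast
    then obtain a b where ab: "a < k" "b < k" "S = ?st a" "T = ?st b" by blast
    then show "e \<in> ?L" using e(1,4) sedge[OF ab(1,2)] by blast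
  qed
  then have "stored_summary us s' = (?R, induced_superedges E ?R)"
    unfolding stored_summary_def st k by simp
  then show ?thesis
    using assms(1,3) unfolding algorithm_output_iff supernodes_built_def by blast
qed

section \<open>Polynomial bounds and the decision problem\<close>

lemma nat_poly_mono: "x \<le> y \<Longrightarrow> poly p x \<le> poly p y" for p :: "nat poly"
  by (induction p) (auto intro: add_mono mult_mono)

lemma presents_encode_graph: "presents us E (encode_graph (us, E))"
  by (simp add: presents_def adjacent_at_def)

lemma presents_encode_decision: "presents us E (encode_decision ((us, E), b))" for b :: nat
  by (simp add: presents_encode_graph del: encode_graph.simps)

lemma presented_graphsD:
  "(us, E) \<in> presented_graphs \<Longrightarrow> distinct us \<and> simple_graph (set us) E"
  by (simp add: presented_graphs_def)

lemma length_le_graph_size: "distinct us \<Longrightarrow> length us \<le> graph_size (us, E)"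
  by (simp add: distinct_card)

lemma summarize_poly_time:
  "runs_in_poly_time summarize (presented_graphs :: ('a list \<times> 'a set set) set)
    graph_size encode_graph (\<lambda>(us, E) s. algorithm_output (set us) E (stored_summary us s))"
  unfolding runs_in_poly_time_def
\<comment> \<open>The coefficients of the expanded sum \<open>?T1 + ?T2\<close> of the two phase
  bounds, in the number of nodes.\<close>
proof (rule exI[of _ "[:28, 88, 98, 108, 54:]"], rule ballI)
  let ?p = "[:28, 88, 98, 108, 54:] :: nat poly"
  fix g assume g: "g \<in> (presented_graphs :: ('a list \<times> 'a set set) set)"
  obtain us E where gE: "g = (us, E)" by (cases g)
  have us: "distinct us" "simple_graph (set us) E" using g gE presented_graphsD by blast+
  let ?s = "encode_graph (us, E)" and ?n = "length us"
  let ?T1 = "16 + ?n * (60 + ?n * (70 + ?n * 80))"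
  let ?T2 = "12 + ?n * (28 + ?n * (28 + ?n * (28 + ?n * 54)))"
  have "run build_supernodes ?s ?T1 (supernodes_built us E)"
    by (rule run_build_supernodes[OF us presents_encode_graph]) simp
  note built = run_unwritten[OF this]
  have "run summarize ?s (?T1 + ?T2) (\<lambda>s'. algorithm_output (set us) E (stored_summary us s'))"
    unfolding summarize_def
  proof (rule run_Seq[OF built])
    fix s assume s: "supernodes_built us E s \<and>
      (\<forall>x i j. x \<notin> written build_supernodes \<longrightarrow> s (x, i, j) = ?s (x, i, j))"
    have "run build_superedges s ?T2
        (superedges_inv s ({..<s (''k'', 0, 0)} \<times> {..<s (''k'', 0, 0)} \<times> {..<?n} \<times> {..<?n}))"
      by (rule run_build_superedges) (use s in \<open>auto simp: supernodes_built_def presents_n\<close>)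
    then show "run build_superedges s ?T2 (\<lambda>s'. algorithm_output (set us) E (stored_summary us s'))"
      by (rule run_mono) (use s stored_summary_output in blast)+
  qed
  moreover have "?T1 + ?T2 \<le> poly ?p (graph_size (us, E))"
  proof -
    have "?T1 + ?T2 = poly ?p ?n" by (simp add: algebra_simps)
    also have "\<dots> \<le> poly ?p (graph_size (us, E))"
      by (rule nat_poly_mono) (rule length_le_graph_size[OF us(1)])
    finally show ?thesis .
  qed
  ultimately show "\<exists>t s. exec summarize (encode_graph g) t s \<and> t \<le> poly ?p (graph_size g) \<and>
      (case g of (us, E) \<Rightarrow> \<lambda>s. algorithm_output (set us) E (stored_summary us s)) s"
    unfolding run_def gE prod.case using le_trans by blast
qed

text \<open>The first phase suffices, as \<open>k\<close> is then already the minimum. The cell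
  \<open>answer\<close> is initially 0, so only a positive answer is written.\<close>

definition decide :: com where
  "decide = build_supernodes ;; When (Not (Less (Var ''bound'') (Var ''k''))) (SetVar ''answer'' (N 1))"

text \<open>The stored supernodes with their induced superedges are an output of the algorithm,
  hence a minimum lossless summary, and they number exactly \<open>k\<close>.\<close>

lemma summarizable_iff:
  assumes "simple_graph (set us) E" "supernodes_built us E s"
  shows "((us, E), b) \<in> summarizable \<longleftrightarrow> s (''k'', 0, 0) \<le> b"
proof -
  let ?R = "stored_supernode us s ` {..<s (''k'', 0, 0)}"
  have "algorithm_output (set us) E (?R, induced_superedges E ?R)"
    using assms(2) unfolding algorithm_output_iff supernodes_built_def by blast
  from algorithm_output_minimum[OF assms(1) this]
  have min: "is_minimum_lossless_summary (set us) E (?R, induced_superedges E ?R)" .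
  have num: "num_supernodes (?R, induced_superedges E ?R) = s (''k'', 0, 0)"
    using assms(2) by (simp add: supernodes_built_def num_supernodes_def)
  show ?thesis
  proof
    assume "((us, E), b) \<in> summarizable"
    then obtain \<Sigma> where "is_lossless_summary (set us) E \<Sigma>" "num_supernodes \<Sigma> \<le> b"
      unfolding summarizable_def by blast
    then show "s (''k'', 0, 0) \<le> b"
      using min num unfolding is_minimum_lossless_summary_def by fastforce
  next
    assume "s (''k'', 0, 0) \<le> b"
    then have "is_lossless_summary (set us) E (?R, induced_superedges E ?R) \<and>
        num_supernodes (?R, induced_superedges E ?R) \<le> b"
      using min num unfolding is_minimum_lossless_summary_def by simp
    then show "((us, E), b) \<in> summarizable" unfolding summarizable_def by blast
  qed
qed

lemma summarization_in_P: "summarization_in_P TYPE('a)"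
  unfolding summarization_in_P_def runs_in_poly_time_def
\<comment> \<open>The bound of the first phase plus 13 for the final comparison and store, hence 29
  = 16 + 13. The time does not depend on \<open>b\<close>.\<close>
proof (rule exI[of _ decide], rule exI[of _ "[:29, 60, 70, 80:]"], rule ballI)
  let ?p = "[:29, 60, 70, 80:] :: nat poly"
  fix x assume x: "x \<in> (presented_graphs :: ('a list \<times> 'a set set) set) \<times> (UNIV :: nat set)"
  obtain us E b where xb: "x = ((us, E), b)" by (metis prod.exhaust)
  have us: "distinct us" "simple_graph (set us) E" using x xb presented_graphsD by blast+
  let ?s = "encode_decision ((us, E), b)" and ?n = "length us"
  let ?T = "16 + ?n * (60 + ?n * (70 + ?n * 80))"
  let ?ans = "if ((us, E), b) \<in> summarizable then 1 else 0 :: nat"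
  let ?answer = "When (Not (Less (Var ''bound'') (Var ''k''))) (SetVar ''answer'' (N 1))"
  have "run build_supernodes ?s ?T (supernodes_built us E)"
    by (rule run_build_supernodes[OF us presents_encode_decision]) simp
  note built = run_unwritten[OF this]
  have "run decide ?s (?T + 13) (\<lambda>s'. s' (''answer'', 0, 0) = ?ans)"
    unfolding decide_def
  proof (rule run_Seq[OF built])
    fix s assume s: "supernodes_built us E s \<and>
      (\<forall>x i j. x \<notin> written build_supernodes \<longrightarrow> s (x, i, j) = ?s (x, i, j))"
    then have frame: "s (''bound'', 0, 0) = b" "s (''answer'', 0, 0) = 0" by simp_all
    have "((us, E), b) \<in> summarizable \<longleftrightarrow> s (''k'', 0, 0) \<le> b"
      using summarizable_iff us(2) s by blast
    then show "run ?answer s 13 (\<lambda>s'. s' (''answer'', 0, 0) = ?ans)"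
      by (intro run_loop_free) (simp_all add: frame)
  qed
  moreover have "?T + 13 \<le> poly ?p (decision_size x)"
  proof -
    have "?T + 13 = poly ?p ?n" by simp
    also have "\<dots> \<le> poly ?p (decision_size x)"
      by (rule nat_poly_mono) (use length_le_graph_size[OF us(1)] xb in \<open>simp add: trans_le_add1\<close>)
    finally show ?thesis .
  qed
  ultimately show "\<exists>t s. exec decide (encode_decision x) t s \<and> t \<le> poly ?p (decision_size x) \<and>
      s (''answer'', 0, 0) = (if x \<in> summarizable then 1 else 0)"
    unfolding run_def xb using le_trans by blast
qed

text \<open>The last two conjuncts meet in \<open>algorithm_output\<close>: the machine computes one
  admissible output in polynomial time, and every admissible output, whatever the order of visits,
  is a minimum lossless summary.\<close>

theorem theorem3p3:
  shows "summarization_in_P TYPE('a) \<and>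
    runs_in_poly_time summarize (presented_graphs :: ('a list \<times> 'a set set) set)
      graph_size encode_graph
      (\<lambda>(us, E) s. algorithm_output (set us) E (stored_summary us s)) \<and>
    (\<forall>(V :: 'a set) E \<Sigma>. simple_graph V E \<longrightarrow> algorithm_output V E \<Sigma> \<longrightarrow>
      is_minimum_lossless_summary V E \<Sigma>)"
proof (intro conjI allI impI)
  show "summarization_in_P TYPE('a)" by (rule summarization_in_P)
  show "runs_in_poly_time summarize (presented_graphs :: ('a list \<times> 'a set set) set)
      graph_size encode_graph
      (\<lambda>(us, E) s. algorithm_output (set us) E (stored_summary us s))"
    by (rule summarize_poly_time)
  show "is_minimum_lossless_summary V E \<Sigma>"
    if "simple_graph V E" "algorithm_output V E \<Sigma>" for V :: "'a set" and E \<Sigma>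
    using that by (rule algorithm_output_minimum)
qed

end
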